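(* Let $E_2(q)=1-24\sum_{n\ge1}\frac{nq^n}{1-q^n}$ and $\mathscr P=E_2(q^5)$. Let $A,B$ be as in the context. Then $$q\frac{dA}{dq}=\frac{1}{60}A\left(-5A^{10}-66A^5B^5+7B^{10}+5\mathscr P\right),\qquad q\frac{dB}{dq}=\frac{1}{60}B\left(-5B^{10}+66A^5B^5+7A^{10}+5\mathscr P\right),$$ $$q\frac{d\mathscr P}{dq}=\frac{5}{12}\left(\mathscr P^2-B^{20}+12B^{15}A^5-14B^{10}A^{10}-12B^5A^{15}-A^{20}\right).$$
   Context: $|q|<1$, $(a;q)_\infty=\prod_{j\ge0}(1-aq^j)$, $(a_1,\dots,a_r;q)_\infty=\prod_i(a_i;q)_\infty$. The functions $A,B$ are defined by $A^5=q\frac{(q;q)_\infty^2}{(q^2,q^3;q^5)_\infty^5}$ and $B^5=\frac{(q;q)_\infty^2}{(q,q^4;q^5)_\infty^5}$, i.e. $A=q^{1/5}\frac{(q;q)_\infty^{2/5}}{(q^2,q^3;q^5)_\infty}$ and $B=\frac{(q;q)_\infty^{2/5}}{(q,q^4;q^5)_\infty}$ (fifth roots normalized to have leading coefficient $1$). *)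

theory Defs
  imports "HOL-Complex_Analysis.Complex_Analysis"
begin

definition qpoch :: "complex \<Rightarrow> complex \<Rightarrow> complex" where
  "qpoch a q = (\<Prod>j. 1 - a * q ^ j)"

definition E2 :: "complex \<Rightarrow> complex" where
  "E2 q = 1 - 24 * (\<Sum>n. of_nat (Suc n) * q ^ Suc n / (1 - q ^ Suc n))"

definition scriptP :: "complex \<Rightarrow> complex" where
  "scriptP q = E2 (q ^ 5)"

text \<open>
  The power \<open>(q;q)\<^sub>\<infinity>\<close> to the \<open>2/5\<close>, normalized to be \<open>1\<close> at \<open>q = 0\<close>.  Taking the principal
  value of \<open>(q;q)\<^sub>\<infinity> powr (2/5)\<close> might introduce branch jumps inside the unit disc.  Instead we use
  principal logarithms of the single factors, which lie in the right half-plane; this yields the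
  holomorphic branch on the whole disc (see the lemmas \<open>euler_two_fifths_power5\<close>,
  \<open>euler_two_fifths_0\<close> and \<open>holomorphic_euler_two_fifths\<close>).
\<close>

definition euler_two_fifths :: "complex \<Rightarrow> complex" where
  "euler_two_fifths q = exp (2 / 5 * (\<Sum>j. Ln (1 - q * q ^ j)))"

text \<open>
  The factor \<open>q\<close> to the \<open>1/5\<close> in \<open>A\<close> is multivalued on the punctured disc, so a choice \<open>r\<close> of the
  fifth root is a parameter: \<open>r q ^ 5 = q\<close>.
\<close>

definition fun_A :: "(complex \<Rightarrow> complex) \<Rightarrow> complex \<Rightarrow> complex" where
  "fun_A r q = r q * euler_two_fifths q / (qpoch (q ^ 2) (q ^ 5) * qpoch (q ^ 3) (q ^ 5))"

definition fun_B :: "complex \<Rightarrow> complex" where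
  "fun_B q = euler_two_fifths q / (qpoch q (q ^ 5) * qpoch (q ^ 4) (q ^ 5))"

lemma norm_mult_power_less_1:
  fixes q :: complex
  assumes "norm q < 1"
  shows "norm (q * q ^ j) < 1"
proof -
  have "norm q * norm q ^ j \<le> norm q * 1"
    using assms by (intro mult_left_mono power_le_one) simp_all
  thus ?thesis
    using assms by (simp add: norm_mult norm_power)
qed

lemma one_minus_power_neq_0:
  fixes q :: complex
  assumes "norm q < 1"
  shows "1 - q * q ^ j \<noteq> 0"
proof
  assume "1 - q * q ^ j = 0"
  hence "norm (q * q ^ j) = 1" by simp
  thus False using norm_mult_power_less_1[OF assms, of j] by linarith
qed

lemma summable_Ln_euler:
  fixes q :: complex
  assumes "norm q < 1"
  shows "summable (\<lambda>j. Ln (1 - q * q ^ j))"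
proof -
  have "summable (\<lambda>j. norm (- (q * q ^ j)))"
    using assms by (simp add: norm_mult norm_power summable_mult summable_geometric)
  moreover have "- (q * q ^ j) \<noteq> -1" for j
    using one_minus_power_neq_0[OF assms, of j] by auto
  ultimately have "convergent_prod (\<lambda>j. 1 + - (q * q ^ j))"
    by (rule summable_imp_convergent_prod_complex)
  thus ?thesis
    using one_minus_power_neq_0[OF assms] by (intro summable_Ln_complex) simp_all
qed

lemma euler_two_fifths_power5:
  assumes "norm q < 1"
  shows "euler_two_fifths q ^ 5 = qpoch q q ^ 2"
proof -
  have "qpoch q q = (\<Prod>j. exp (Ln (1 - q * q ^ j)))"
    unfolding qpoch_def using one_minus_power_neq_0[OF assms] by simp
  also have "\<dots> = exp (\<Sum>j. Ln (1 - q * q ^ j))"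
    by (rule prodinf_exp) (rule summable_Ln_euler[OF assms])
  finally show ?thesis
    by (simp add: euler_two_fifths_def flip: exp_of_nat_mult)
qed

lemma euler_two_fifths_0: "euler_two_fifths 0 = 1"
  by (simp add: euler_two_fifths_def)

lemma holomorphic_euler_two_fifths: "euler_two_fifths holomorphic_on ball 0 1"
proof -
  define f where "f = (\<lambda>(j::nat) (q::complex). Ln (1 - q * q ^ j))"
  have hol: "(\<lambda>q. \<Sum>j<n. f j q) holomorphic_on ball 0 1" for n
    unfolding f_def
  proof (intro holomorphic_intros)
    fix q :: complex and j assume "q \<in> ball 0 1"
    hence "norm (q * q ^ j) < 1"
      by (intro norm_mult_power_less_1) simp
    hence "Re (1 - q * q ^ j) > 0"
      using complex_Re_le_cmod[of "q * q ^ j"] by simp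
    thus "1 - q * q ^ j \<notin> \<real>\<^sub>\<le>\<^sub>0"
      using complex_nonpos_Reals_iff by fastforce
  qed
  have "(\<lambda>q. \<Sum>j. f j q) holomorphic_on ball 0 1"
  proof (rule holomorphic_uniform_sequence[OF open_ball hol])
    fix x :: complex assume x: "x \<in> ball 0 1"
    obtain d where d: "d > 0" "cball x d \<subseteq> ball 0 1"
      using x open_contains_cball[of "ball (0::complex) 1"] open_ball by blast
    have "cball x d \<noteq> {}" "continuous_on (cball x d) norm"
      using d(1) by (auto intro!: continuous_intros)
    then obtain q0 where q0: "q0 \<in> cball x d" "\<And>q. q \<in> cball x d \<Longrightarrow> norm q \<le> norm q0"
      using continuous_attains_sup[of "cball x d" norm] by auto
    have q01: "norm q0 < 1" using q0(1) d(2) by auto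
    have lim0: "(\<lambda>j. norm q0 * norm q0 ^ j) \<longlonglongrightarrow> 0"
      using q01 by (intro tendsto_mult_right_zero LIMSEQ_power_zero) simp
    have "\<forall>\<^sub>F j in sequentially. \<forall>q\<in>cball x d. norm (f j q) \<le> 2 * (norm q0 * norm q0 ^ j)"
      using order_tendstoD(2)[OF lim0, of "1 / 2"]
    proof (simp, elim eventually_mono, intro ballI)
      fix j q assume j: "norm q0 * norm q0 ^ j * 2 < 1" and q: "q \<in> cball x d"
      have le: "norm (- (q * q ^ j)) \<le> norm q0 * norm q0 ^ j"
        using q0(2)[OF q] by (simp add: norm_mult norm_power mult_mono power_mono)
      have "norm (Ln (1 + - (q * q ^ j))) \<le> 2 * norm (- (q * q ^ j))"
        by (rule norm_Ln_le) (use le j in linarith)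
      thus "norm (f j q) \<le> 2 * (norm q0 * norm q0 ^ j)"
        using le by (simp add: f_def)
    qed
    hence "uniform_limit (cball x d) (\<lambda>N q. \<Sum>j<N. f j q) (\<lambda>q. \<Sum>j. f j q) sequentially"
      using q01 by (intro Weierstrass_m_test_ev[where M = "\<lambda>j. 2 * (norm q0 * norm q0 ^ j)"]
                      summable_mult summable_geometric) auto
    thus "\<exists>d>0. cball x d \<subseteq> ball 0 1 \<and>
        uniform_limit (cball x d) (\<lambda>N q. \<Sum>j<N. f j q) (\<lambda>q. \<Sum>j. f j q) sequentially"
      using d by blast
  qed
  thus ?thesis
    unfolding euler_two_fifths_def f_def by (intro holomorphic_intros)
qed

lemma fun_A_power5:
  assumes "norm q < 1" "r q ^ 5 = q"
  shows "fun_A r q ^ 5 = q * qpoch q q ^ 2 / (qpoch (q ^ 2) (q ^ 5) * qpoch (q ^ 3) (q ^ 5)) ^ 5"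
  using assms by (simp add: fun_A_def power_divide power_mult_distrib euler_two_fifths_power5)

lemma fun_B_power5:
  assumes "norm q < 1"
  shows "fun_B q ^ 5 = qpoch q q ^ 2 / (qpoch q (q ^ 5) * qpoch (q ^ 4) (q ^ 5)) ^ 5"
  using assms by (simp add: fun_B_def power_divide euler_two_fifths_power5)

end

theory Submission
  imports Defs
begin

text \<open>
  Put \<open>p = q\<^sup>5\<close> and \<open>\<rho>(z) = \<Sum> z\<^sup>n / (1 - p\<^sup>n)\<close>, summed over all integers with the term \<open>1/2\<close> at
  \<open>n = 0\<close>; this is the logarithmic derivative of a theta function of nome \<open>p\<close>.  The partial fraction
  expansion of \<open>1 / ((1 - a) (1 - b))\<close> in terms of \<open>1 / (1 - a b)\<close> expresses
  \<open>\<rho>(x) \<rho>(y) - \<rho>(x y) (\<rho>(x) + \<rho>(y))\<close> by the Lambert series \<open>\<Sum> p\<^sup>n z\<^sup>n / (1 - p\<^sup>n)\<^sup>2\<close> at \<open>x\<close>, \<open>y\<close> and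
  \<open>x y\<close>; together with a formula for \<open>\<rho>\<^sup>2\<close>, in which \<open>E\<^sub>2(p)\<close> appears, and with derivatives of both
  formulas, it determines, at \<open>z = q\<close> and \<open>z = q\<^sup>2\<close>, every Lambert series that occurs as a polynomial in
  \<open>\<rho>(q)\<close>, \<open>\<rho>(q\<^sup>2)\<close> and \<open>E\<^sub>2(p)\<close>.  Since the operator \<open>q d/dq\<close> maps these series to series of the
  same kind, the weight one forms \<open>\<rho>(q) - 3 \<rho>(q\<^sup>2) + 1\<close> and \<open>3 \<rho>(q) + \<rho>(q\<^sup>2) - 1\<close> and \<open>E\<^sub>2(p)\<close> satisfy a
  closed differential system.  The logarithmic derivatives of the products \<open>A\<^sup>5\<close> and \<open>B\<^sup>5\<close> are
  polynomials in the same quantities and agree with those of the two forms, so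
  the forms equal \<open>A\<^sup>5\<close> and \<open>B\<^sup>5\<close>.
\<close>

section \<open>Bilateral Lambert series\<close>

text \<open>Applying \<open>t d/dt\<close> to a power series multiplies its coefficients by
  \<open>n\<close> and keeps the disc of convergence, so \<open>j\<close> can be raised one step at
  a time.\<close>

lemma summable_poly_geometric:
  fixes t :: real
  assumes "norm t < 1"
  shows "summable (\<lambda>n. real n ^ j * t ^ n)"
  using assms
proof (induction j arbitrary: t)
  case 0
  thus ?case by (simp add: summable_geometric)
next
  case (Suc j)
  have "summable (\<lambda>n. diffs (\<lambda>n. real n ^ j) n * t ^ n)"
    by (rule termdiff_converges[of _ 1]) (use Suc in auto)
  hence "summable (\<lambda>n. t * (diffs (\<lambda>n. real n ^ j) n * t ^ n))"
    by (rule summable_mult)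
  also have "(\<lambda>n. t * (diffs (\<lambda>n. real n ^ j) n * t ^ n)) = (\<lambda>n. real (Suc n) ^ Suc j * t ^ Suc n)"
    by (simp add: diffs_def algebra_simps)
  finally show ?case
    by (subst (asm) summable_Suc_iff)
qed

text \<open>The integers are two copies of the naturals glued at \<open>0\<close>. On each copy the
  majorant is a power of \<open>n\<close> times a geometric sequence, and comparison gives absolute
  summability.\<close>

lemma abs_summable_int_geometric:
  fixes f :: "int \<Rightarrow> complex" and t C :: real
  assumes t: "0 \<le> t" "t < 1"
    and bound: "\<And>n. norm (f n) \<le> C * t ^ nat \<bar>n\<bar>"
  shows "(\<lambda>n. of_int n ^ j * f n) summable_on UNIV"
proof -
  define h where "h = (\<lambda>n::int. C * (real (nat \<bar>n\<bar>) ^ j * t ^ nat \<bar>n\<bar>))"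
  have nat: "(\<lambda>n. C * (real n ^ j * t ^ n)) summable_on (UNIV :: nat set)"
    using summable_poly_geometric[of t j] t
    by (intro norm_summable_imp_summable_on)
       (simp add: abs_mult summable_mult t)
  have 1: "h summable_on {0..}"
  proof -
    have "h summable_on (int ` UNIV)"
      by (subst summable_on_reindex) (use nat in \<open>auto simp: h_def o_def\<close>)
    moreover have "int ` UNIV = {0..}"
    proof -
      have "x \<in> int ` UNIV" if "x \<ge> 0" for x
        using that by (intro image_eqI[of _ _ "nat x"]) auto
      thus ?thesis by auto
    qed
    ultimately show ?thesis by simp
  qed
  have 2: "h summable_on {..0}"
  proof -
    have "h summable_on ((\<lambda>n. - int n) ` UNIV)"
      by (subst summable_on_reindex) (use nat in \<open>auto simp: h_def o_def inj_def\<close>)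
    moreover have "(\<lambda>n. - int n) ` UNIV = {..0}"
    proof -
      have "x \<in> (\<lambda>n. - int n) ` UNIV" if "x \<le> 0" for x
        using that by (intro image_eqI[of _ _ "nat (-x)"]) auto
      thus ?thesis by auto
    qed
    ultimately show ?thesis by simp
  qed
  have "h summable_on ({0..} \<union> ({..0} - {0..}))"
    using 1 2 by (intro summable_on_Un_disjoint) (auto intro: summable_on_subset_banach)
  also have "{0..} \<union> ({..0} - {0..}) = (UNIV :: int set)" by auto
  finally have "h summable_on UNIV" .
  moreover have "norm (of_int n ^ j * f n) \<le> h n" for n
  proof -
    have "norm (of_int n ^ j * f n) = real (nat \<bar>n\<bar>) ^ j * norm (f n)"
      by (simp add: norm_mult norm_power)
    also have "\<dots> \<le> real (nat \<bar>n\<bar>) ^ j * (C * t ^ nat \<bar>n\<bar>)"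
      by (intro mult_left_mono bound) auto
    finally show ?thesis by (simp add: h_def algebra_simps)
  qed
  ultimately have "(\<lambda>n. norm (of_int n ^ j * f n)) summable_on UNIV"
    by (intro Infinite_Sum.abs_summable_on_comparison_test'[of h]) auto
  thus ?thesis by (rule abs_summable_summable)
qed

text \<open>Summability of a complex family over a set is automatically absolute. Hence the product
  family is summable on \<open>A \<times> B\<close> and can be summed row by row.\<close>

lemma has_sum_times_complex:
  fixes f :: "'a \<Rightarrow> complex" and g :: "'b \<Rightarrow> complex"
  assumes "countable A" "countable B"
    and f: "(f has_sum F) A" and g: "(g has_sum G) B"
  shows "((\<lambda>(x, y). f x * g y) has_sum F * G) (A \<times> B)"
proof -
  have "Infinite_Set_Sum.abs_summable_on f A" "Infinite_Set_Sum.abs_summable_on g B"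
    using f g summable_on_iff_abs_summable_on_complex abs_summable_equivalent
      has_sum_imp_summable by blast+
  hence "Infinite_Set_Sum.abs_summable_on (\<lambda>(x, y). f x * g y) (A \<times> B)"
    using assms(1,2) by (intro abs_summable_on_product)
  hence s: "(\<lambda>(x, y). f x * g y) summable_on A \<times> B"
    using abs_summable_equivalent abs_summable_summable by blast
  show ?thesis
    by (rule has_sum_SigmaI[OF _ _ s, where g = "\<lambda>x. f x * G"])
       (auto intro!: has_sum_cmult_right has_sum_cmult_left f g)
qed

lemma has_sum_diff:
  fixes f g :: "'a \<Rightarrow> complex"
  assumes "(f has_sum F) A" "(g has_sum G) A"
  shows "((\<lambda>x. f x - g x) has_sum F - G) A"
  using has_sum_add[OF assms(1) has_sum_uminusI[OF assms(2)]] by simp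

text \<open>Used to place a series over the integers on an axis or on the diagonal of the lattice of
  pairs, where the correction terms of \<open>kc_addition\<close> live.\<close>

lemma has_sum_supported:
  assumes "inj h" "(f has_sum S) UNIV" "\<And>x. F (h x) = f x" "\<And>y. y \<notin> range h \<Longrightarrow> F y = 0"
  shows "(F has_sum S) UNIV"
proof -
  have "(F has_sum S) (range h)"
    by (subst has_sum_reindex) (use assms in \<open>auto simp: o_def\<close>)
  also have "?this \<longleftrightarrow> ?thesis"
    by (rule has_sum_cong_neutral) (use assms(4) in auto)
  finally show ?thesis .
qed

text \<open>
  The values at \<open>n = 0\<close> are regularizations, chosen such that \<open>kc p (-n) = 1 - kc p n\<close> and the
  addition formula \<open>kc_addition\<close> hold without exceptional cases.
\<close>

definition kc :: "complex \<Rightarrow> int \<Rightarrow> complex" where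
  "kc p n = (if n = 0 then 1 / 2 else 1 / (1 - p powi n))"

definition kg :: "complex \<Rightarrow> int \<Rightarrow> complex" where
  "kg p n = (if n = 0 then - 1 / 12 else p powi n / (1 - p powi n) ^ 2)"

text \<open>For \<open>j = 0\<close> this is the logarithmic derivative of a theta function of nome
  \<open>p\<close>, and \<open>j\<close> counts applications of \<open>z d/dz\<close>. The series
  converges in the annulus \<open>|p| < |z| < 1\<close>.\<close>

definition kS :: "nat \<Rightarrow> complex \<Rightarrow> complex \<Rightarrow> complex" where
  "kS j p z = (\<Sum>\<^sub>\<infinity>n. of_int n ^ j * (kc p n * z powi n))"

text \<open>Since \<open>p d/dp\<close> maps \<open>1 / (1 - p^n)\<close> to
  \<open>n p^n / (1 - p^n)^2\<close>, \<open>kG (j + 1)\<close> is the \<open>p d/dp\<close>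
  derivative of \<open>kS j\<close>. Its annulus of convergence \<open>|p| < |z| < 1 / |p|\<close>
  contains \<open>z = 1\<close>.\<close>

definition kG :: "nat \<Rightarrow> complex \<Rightarrow> complex \<Rightarrow> complex" where
  "kG j p z = (\<Sum>\<^sub>\<infinity>n. of_int n ^ j * (kg p n * z powi n))"

lemma powi_neq_1:
  fixes p :: complex
  assumes p: "p \<noteq> 0" "norm p < 1" and "n \<noteq> 0"
  shows "p powi n \<noteq> 1"
proof
  assume "p powi n = 1"
  hence n1: "norm p powi n = 1" by (metis norm_one norm_power_int)
  have *: "norm p ^ k < 1" if "k > 0" for k
    using p that by (simp add: power_Suc_less_one power_less_one_iff)
  show False
  proof (cases "n > 0")
    case True
    thus ?thesis using n1 *[of "nat n"] by (simp add: power_int_def)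
  next
    case False
    thus ?thesis using n1 *[of "nat (-n)"] assms by (simp add: power_int_def field_simps)
  qed
qed

lemma norm_inverse_one_minus_power_le:
  fixes p :: complex
  assumes "norm p < 1" "n > 0"
  shows "norm (1 / (1 - p ^ n)) \<le> 1 / (1 - norm p)"
proof -
  have "norm p ^ n \<le> norm p ^ 1"
    using assms by (intro power_decreasing) auto
  hence "1 - norm p \<le> norm (1 - p ^ n)"
    using norm_triangle_ineq2[of 1 "p ^ n"] by (simp add: norm_power)
  thus ?thesis using assms by (simp add: norm_divide frac_le)
qed

lemma kc_eq_neg: "p \<noteq> 0 \<Longrightarrow> norm p < 1 \<Longrightarrow> kc p (-n) = 1 - kc p n"
proof (cases "n = 0")
  assume p: "p \<noteq> 0" "norm p < 1" and n: "n \<noteq> 0"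
  define a where "a = p powi n"
  have a: "a \<noteq> 0" "a \<noteq> 1" "1 - a \<noteq> 0" "a - 1 \<noteq> 0"
    using powi_neq_1[of p n] p n by (auto simp: a_def)
  have "1 / (1 - inverse a) = 1 - 1 / (1 - a)"
    using a by (simp add: divide_simps) (simp add: algebra_simps)
  thus ?thesis using n by (simp add: kc_def power_int_minus a_def)
qed (simp add: kc_def)

lemma kc_bound:
  assumes p: "p \<noteq> 0" "norm p < 1" and z: "z \<noteq> 0"
  shows "norm (kc p n * z powi n) \<le> 1 / (1 - norm p) * max (norm z) (norm (p / z)) ^ nat \<bar>n\<bar>"
proof -
  let ?t = "max (norm z) (norm (p / z))"
  consider "n = 0" | "n > 0" | "n < 0" by linarith
  thus ?thesis
  proof cases
    case 1
    thus ?thesis using p by (auto simp: kc_def field_simps)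
  next
    case 2
    have "norm (kc p n * z powi n) = norm (1 / (1 - p ^ nat n)) * norm z ^ nat n"
      using 2 by (simp add: kc_def power_int_def norm_mult norm_power norm_divide)
    also have "\<dots> \<le> 1 / (1 - norm p) * ?t ^ nat n"
      using 2 p by (intro mult_mono norm_inverse_one_minus_power_le power_mono) auto
    finally show ?thesis using 2 by simp
  next
    case 3
    define m where "m = nat (-n)"
    have m: "m > 0" "n = - int m" using 3 by (auto simp: m_def)
    have "p ^ m \<noteq> 1" using powi_neq_1[OF p, of "int m"] m by simp
    \<comment> \<open>Expanding the fraction by \<open>p^m\<close> turns the negative power of
      \<open>z\<close> into a positive power of \<open>p / z\<close>. This is the source of the
      condition \<open>|p| < |z|\<close> in \<open>kS_has_sum\<close>.\<close>
    hence "kc p n * z powi n = - (1 / (1 - p ^ m)) * (p / z) ^ m"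
      using m p z by (simp add: kc_def power_int_minus field_simps)
    hence "norm (kc p n * z powi n) = norm (1 / (1 - p ^ m)) * norm (p / z) ^ m"
      by (simp only: norm_mult norm_power norm_minus_cancel)
    also have "\<dots> \<le> 1 / (1 - norm p) * ?t ^ m"
      using m p by (intro mult_mono norm_inverse_one_minus_power_le power_mono) auto
    finally show ?thesis using m by simp
  qed
qed

lemma kg_eq: "p \<noteq> 0 \<Longrightarrow> norm p < 1 \<Longrightarrow> n \<noteq> 0 \<Longrightarrow> kg p n = - kc p n * kc p (-n)"
proof -
  assume p: "p \<noteq> 0" "norm p < 1" "n \<noteq> 0"
  define a where "a = p powi n"
  have a: "a \<noteq> 0" "a \<noteq> 1" "1 - a \<noteq> 0" "a - 1 \<noteq> 0"
    using powi_neq_1[of p n] p by (auto simp: a_def)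
  have "a / (1 - a)\<^sup>2 = - (1 / (1 - a)) * (1 / (1 - inverse a))"
    using a by (simp add: divide_simps power2_eq_square) (simp add: algebra_simps)
  thus ?thesis using p by (simp add: kc_def kg_def power_int_minus a_def)
qed

text \<open>For \<open>n \<noteq> 0\<close> the coefficient \<open>kg p n\<close> is even in
  \<open>n\<close> and carries the factor \<open>p^|n|\<close>, so the terms decay with ratio
  \<open>p * z\<close> in one direction and \<open>p / z\<close> in the other.\<close>

lemma kg_bound:
  assumes p: "p \<noteq> 0" "norm p < 1" and z: "z \<noteq> 0"
  shows "norm (kg p n * z powi n) \<le> 1 / (1 - norm p) ^ 2 * max (norm (p * z)) (norm (p / z)) ^ nat \<bar>n\<bar>"
proof -
  let ?t = "max (norm (p * z)) (norm (p / z))"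
  have C: "1 \<le> 1 / (1 - norm p)^2"
    using p by (simp add: power_le_one)
  consider "n = 0" | "n > 0" | "n < 0" by linarith
  thus ?thesis
  proof cases
    case 1
    thus ?thesis using C by (simp add: kg_def)
  next
    case 2
    have "norm (kg p n * z powi n) = norm (1 / (1 - p ^ nat n)) ^ 2 * norm (p * z) ^ nat n"
      using 2 by (simp add: kg_def power_int_def norm_mult norm_power norm_divide power_divide power_mult_distrib)
    also have "\<dots> \<le> (1 / (1 - norm p))^2 * ?t ^ nat n"
      using 2 p by (intro mult_mono norm_inverse_one_minus_power_le power_mono) auto
    finally show ?thesis using 2 by (simp add: power_divide)
  next
    case 3
    define m where "m = nat (-n)"
    have m: "m > 0" "n = - int m" using 3 by (auto simp: m_def)
    have "p ^ m \<noteq> 1" using powi_neq_1[OF p, of "int m"] m by simp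
    hence "kg p n * z powi n = (1 / (1 - p ^ m)) ^ 2 * (p / z) ^ m"
      using m p z by (simp add: kg_def power_int_minus field_simps power2_eq_square)
    hence "norm (kg p n * z powi n) = norm (1 / (1 - p ^ m)) ^ 2 * norm (p / z) ^ m"
      by (simp add: norm_mult norm_power)
    also have "\<dots> \<le> (1 / (1 - norm p)) ^ 2 * ?t ^ m"
      using m p by (intro mult_mono norm_inverse_one_minus_power_le power_mono) auto
    finally show ?thesis using m by (simp add: power_divide)
  qed
qed

lemma kS_has_sum:
  assumes "p \<noteq> 0" "norm p < norm z" "norm z < 1"
  shows "((\<lambda>n. of_int n ^ j * (kc p n * z powi n)) has_sum kS j p z) UNIV"
proof -
  have z: "z \<noteq> 0" "norm p < 1" using assms by auto
  have "norm (p / z) < 1" using assms z by (simp add: norm_divide)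
  hence "(\<lambda>n. of_int n ^ j * (kc p n * z powi n)) summable_on UNIV"
    using assms z by (intro abs_summable_int_geometric[OF _ _ kc_bound]) (auto simp: le_max_iff_disj)
  thus ?thesis unfolding kS_def by (rule has_sum_infsum)
qed

lemma kG_has_sum:
  assumes "p \<noteq> 0" "norm p < 1" "norm p < norm z" "norm (p * z) < 1"
  shows "((\<lambda>n. of_int n ^ j * (kg p n * z powi n)) has_sum kG j p z) UNIV"
proof -
  have z: "z \<noteq> 0" using assms by auto
  have "norm (p / z) < 1" using assms z by (simp add: norm_divide)
  hence "(\<lambda>n. of_int n ^ j * (kg p n * z powi n)) summable_on UNIV"
    using assms z by (intro abs_summable_int_geometric[OF _ _ kg_bound]) (auto simp: le_max_iff_disj)
  thus ?thesis unfolding kG_def by (rule has_sum_infsum)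
qed

text \<open>With \<open>a = p^m\<close> and \<open>b = p^n\<close> this is the partial fraction
  expansion of \<open>1 / ((1 - a) (1 - b))\<close>. When \<open>m\<close>, \<open>n\<close> or
  \<open>m - n\<close> vanishes, the regularized value \<open>1 / 2\<close> replaces a pole, and the
  defect is a \<open>kg\<close> term.\<close>

lemma kc_addition:
  assumes p: "p \<noteq> 0" "norm p < 1"
  shows "kc p m * kc p n - kc p n * kc p (m - n) - kc p m * kc p (n - m) =
    (if m = 0 then kg p n else 0) + (if n = 0 then kg p m else 0) + (if m = n then kg p m else 0)"
proof -
  consider "m = 0" | "n = 0" "m \<noteq> 0" | "m = n" "m \<noteq> 0" | "m \<noteq> n" "m \<noteq> 0" "n \<noteq> 0" by blast
  thus ?thesis
  proof cases
    case 1
    show ?thesis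
    proof (cases "n = 0")
      case True
      \<comment> \<open>For \<open>m = n = 0\<close> the left side is \<open>- 1 / 4\<close> and all
        three corrections occur, which forces the value \<open>kg p 0 = - 1 / 12\<close>.\<close>
      thus ?thesis using 1 by (simp add: kc_def kg_def)
    next
      case False
      thus ?thesis using 1 kg_eq[OF p False] by (simp add: kc_def)
    qed
  next
    case 2
    thus ?thesis using kg_eq[OF p, of m] by (simp add: kc_def)
  next
    case 3
    hence "kg p n = kc p n * kc p n - kc p n"
      using kg_eq[OF p, of n] kc_eq_neg[OF p, of n] by (simp add: algebra_simps)
    thus ?thesis using 3 by (simp add: kc_def[of p 0])
  next
    case 4
    define a b where "a = p powi m" and "b = p powi n"
    have ab: "a \<noteq> 0" "b \<noteq> 0" "a \<noteq> 1" "b \<noteq> 1"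
      using 4 p powi_neq_1[OF p] by (auto simp: a_def b_def)
    have c: "p powi (m - n) = a / b" "p powi (n - m) = b / a"
      using p by (simp_all add: a_def b_def power_int_diff)
    have "a / b \<noteq> 1" using powi_neq_1[OF p, of "m - n"] 4 c by auto
    hence "a \<noteq> b" using ab by auto
    hence "kc p (m - n) = b / (b - a)" "kc p (n - m) = - (a / (b - a))"
      using 4 ab unfolding kc_def c by (simp_all add: divide_simps) (simp add: algebra_simps)
    moreover have "1 / (1 - a) * (1 / (1 - b)) - 1 / (1 - b) * (b / (b - a)) - 1 / (1 - a) * (- (a / (b - a))) = 0"
    proof -
      have "1 - a \<noteq> 0" "1 - b \<noteq> 0" "b - a \<noteq> 0" using ab \<open>a \<noteq> b\<close> by auto
      thus ?thesis by (simp add: divide_simps) (simp add: algebra_simps)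
    qed
    ultimately show ?thesis using 4 by (simp add: kc_def[of p m] kc_def[of p n] a_def b_def)
  qed
qed

section \<open>Addition and square identities\<close>

text \<open>Because \<open>x^(m - n) (x y)^n = x^m y^n\<close>, shearing the index lattice brings a
  product of series at \<open>x\<close> and \<open>x y\<close> into the form of a double series in
  \<open>x^m y^n\<close>, comparable termwise with the product at \<open>x\<close> and
  \<open>y\<close>. \<open>has_sum_shear2\<close> does the same for \<open>y\<close> and
  \<open>x y\<close>.\<close>

lemma has_sum_shear1:
  fixes f g :: "int \<Rightarrow> complex"
  assumes "(f has_sum F) UNIV" "(g has_sum G) UNIV"
  shows "((\<lambda>(m, n). f (m - n) * g n) has_sum F * G) UNIV"
proof -
  have "((\<lambda>(m, n). f m * g n) has_sum F * G) UNIV"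
    using has_sum_times_complex[OF countableI_type countableI_type assms] by simp
  also have "?this \<longleftrightarrow> ?thesis"
    by (rule has_sum_reindex_bij_witness[of _ "\<lambda>(m, n). (m - n, n)" "\<lambda>(m, n). (m + n, n)"]) auto
  finally show ?thesis .
qed

lemma has_sum_shear2:
  fixes f g :: "int \<Rightarrow> complex"
  assumes "(f has_sum F) UNIV" "(g has_sum G) UNIV"
  shows "((\<lambda>(m, n). f (n - m) * g m) has_sum F * G) UNIV"
proof -
  have "((\<lambda>(m, n). f (m - n) * g n) has_sum F * G) UNIV"
    by (rule has_sum_shear1[OF assms])
  also have "?this \<longleftrightarrow> ?thesis"
    by (rule has_sum_reindex_bij_witness[of _ "\<lambda>(m, n). (n, m)" "\<lambda>(m, n). (n, m)"]) auto
  finally show ?thesis .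
qed

section \<open>The addition formula and its derivatives in \<open>x\<close> and
  \<open>y\<close>\<close>

context
  fixes p x y :: complex
  assumes p: "p \<noteq> 0" and x: "norm x < 1" and y: "norm y < 1" and xy: "norm p < norm (x * y)"
begin

lemma addition_bounds:
  shows "norm p < norm x" "norm p < norm y" "norm (x * y) < 1" "norm p < 1" "norm (p * x) < 1"
    "norm (p * y) < 1" "norm (p * (x * y)) < 1" "x \<noteq> 0" "y \<noteq> 0"
proof -
  have a: "norm (x * y) \<le> norm x" "norm (x * y) \<le> norm y"
    using x y by (simp_all add: norm_mult mult_left_le mult_left_le_one_le)
  show b: "norm p < norm x" "norm p < norm y" "norm (x * y) < 1" "norm p < 1"
    using a xy x y by linarith+
  have c: "norm (p * w) < 1" if "norm w < 1" for w
    using b(4) that by (simp add: norm_mult) (smt (verit) mult_left_le norm_ge_zero)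
  show "norm (p * x) < 1" "norm (p * y) < 1" "norm (p * (x * y)) < 1"
    using c x y b(3) by auto
  show "x \<noteq> 0" "y \<noteq> 0" using b by auto
qed

lemma kS_sums:
  "((\<lambda>n. of_int n ^ j * (kc p n * x powi n)) has_sum kS j p x) UNIV"
  "((\<lambda>n. of_int n ^ j * (kc p n * y powi n)) has_sum kS j p y) UNIV"
  "((\<lambda>n. of_int n ^ j * (kc p n * (x * y) powi n)) has_sum kS j p (x * y)) UNIV"
  using p x y xy addition_bounds by (intro kS_has_sum; simp; fail)+

lemma kG_sums:
  "((\<lambda>n. of_int n ^ j * (kg p n * x powi n)) has_sum kG j p x) UNIV"
  "((\<lambda>n. of_int n ^ j * (kg p n * y powi n)) has_sum kG j p y) UNIV"
  "((\<lambda>n. of_int n ^ j * (kg p n * (x * y) powi n)) has_sum kG j p (x * y)) UNIV"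
  using p x y xy addition_bounds by (intro kG_has_sum; simp; fail)+

text \<open>\<open>kc_addition\<close> is multiplied by
  \<open>x^m y^n = (x y)^n x^(m - n) = (x y)^m y^(n - m)\<close>, each form being chosen so that
  every term becomes a product of summands of two series.\<close>

lemma kc_addition_xy:
  "kc p m * kc p n * x powi m * y powi n
     - kc p n * (x * y) powi n * (kc p (m - n) * x powi (m - n))
     - kc p m * (x * y) powi m * (kc p (n - m) * y powi (n - m))
   = (if m = 0 then kg p n * y powi n else 0) + (if n = 0 then kg p m * x powi m else 0)
     + (if m = n then kg p m * (x * y) powi m else 0)"
proof -
  have x: "x powi m = x powi n * x powi (m - n)" and y: "y powi n = y powi m * y powi (n - m)"
    using addition_bounds by (simp_all flip: power_int_add)
  have "kc p n * (x * y) powi n * (kc p (m - n) * x powi (m - n))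
      = kc p n * kc p (m - n) * (x powi m * y powi n)"
    by (subst x) (simp add: power_int_mult_distrib)
  moreover have "kc p m * (x * y) powi m * (kc p (n - m) * y powi (n - m))
      = kc p m * kc p (n - m) * (x powi m * y powi n)"
    by (subst y) (simp add: power_int_mult_distrib)
  ultimately have "kc p m * kc p n * x powi m * y powi n
     - kc p n * (x * y) powi n * (kc p (m - n) * x powi (m - n))
     - kc p m * (x * y) powi m * (kc p (n - m) * y powi (n - m))
     = (kc p m * kc p n - kc p n * kc p (m - n) - kc p m * kc p (n - m)) * (x powi m * y powi n)"
    by (simp only: left_diff_distrib mult.assoc)
  also have "\<dots> = ((if m = 0 then kg p n else 0) + (if n = 0 then kg p m else 0)
      + (if m = n then kg p m else 0)) * (x powi m * y powi n)"
    using kc_addition[of p m n] p addition_bounds by simp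
  finally show ?thesis
    by (auto simp: power_int_mult_distrib algebra_simps)
qed

text \<open>Summation of \<open>kc_addition_xy\<close> over all pairs: the left side becomes three
  products of series, and the corrections on the two axes and on the diagonal become one
  \<open>kG\<close> series each.\<close>

lemma kS_addition_0:
  "kS 0 p x * kS 0 p y - kS 0 p (x * y) * (kS 0 p x + kS 0 p y)
    = kG 0 p x + kG 0 p y + kG 0 p (x * y)"
proof -
  have "((\<lambda>(m, n). (of_int m ^ 0 * (kc p m * x powi m)) * (of_int n ^ 0 * (kc p n * y powi n)))
      has_sum kS 0 p x * kS 0 p y) UNIV"
    using has_sum_times_complex[OF countableI_type countableI_type kS_sums(1,2)] by (simp only: UNIV_Times_UNIV)
  note L = has_sum_diff[OF has_sum_diff[OF this has_sum_shear1[OF kS_sums(1,3)[of 0]]]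
      has_sum_shear2[OF kS_sums(2,3)[of 0]]]
  have "((\<lambda>(m, n). if m = 0 then kg p n * y powi n else 0) has_sum kG 0 p y) UNIV"
    by (rule has_sum_supported[OF _ kG_sums(2), where h = "\<lambda>n. (0, n)"]) (auto simp: inj_def)
  moreover have "((\<lambda>(m, n). if n = 0 then kg p m * x powi m else 0) has_sum kG 0 p x) UNIV"
    by (rule has_sum_supported[OF _ kG_sums(1), where h = "\<lambda>n. (n, 0)"]) (auto simp: inj_def)
  moreover have "((\<lambda>(m, n). if m = n then kg p m * (x * y) powi m else 0) has_sum kG 0 p (x * y)) UNIV"
    by (rule has_sum_supported[OF _ kG_sums(3), where h = "\<lambda>n. (n, n)"]) (auto simp: inj_def)
  ultimately have R: "((\<lambda>z. (case z of (m, n) \<Rightarrow> if m = 0 then kg p n * y powi n else 0)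
      + (case z of (m, n) \<Rightarrow> if n = 0 then kg p m * x powi m else 0)
      + (case z of (m, n) \<Rightarrow> if m = n then kg p m * (x * y) powi m else 0))
      has_sum kG 0 p y + kG 0 p x + kG 0 p (x * y)) UNIV"
    by (intro has_sum_add)
  have "kS 0 p x * kS 0 p y - kS 0 p x * kS 0 p (x * y) - kS 0 p y * kS 0 p (x * y)
      = kG 0 p y + kG 0 p x + kG 0 p (x * y)"
  proof (rule has_sum_unique[OF L])
    show "((\<lambda>z. (case z of (m, n) \<Rightarrow> (of_int m ^ 0 * (kc p m * x powi m)) * (of_int n ^ 0 * (kc p n * y powi n)))
        - (case z of (m, n) \<Rightarrow> (of_int (m - n) ^ 0 * (kc p (m - n) * x powi (m - n))) * (of_int n ^ 0 * (kc p n * (x * y) powi n)))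
        - (case z of (m, n) \<Rightarrow> (of_int (n - m) ^ 0 * (kc p (n - m) * y powi (n - m))) * (of_int m ^ 0 * (kc p m * (x * y) powi m))))
      has_sum kG 0 p y + kG 0 p x + kG 0 p (x * y)) UNIV"
    proof (rule has_sum_cong[THEN iffD1, OF _ R], goal_cases)
      case (1 z)
      obtain m n where z: "z = (m, n)" by (cases z)
      show ?case
        using kc_addition_xy[of m n] by (simp add: z mult_ac)
    qed
  qed
  thus ?thesis by (simp add: algebra_simps)
qed

text \<open>The same summation with weight \<open>m\<close>, which amounts to applying
  \<open>x d/dx\<close>. The weight kills the axis \<open>m = 0\<close>, and
  \<open>m = n + (m - n)\<close> splits the product of the series at \<open>x\<close> and
  \<open>x * y\<close> in two.\<close>

lemma kS_addition_1:
  "kS 1 p x * kS 0 p y - kS 1 p (x * y) * (kS 0 p x + kS 0 p y) - kS 0 p (x * y) * kS 1 p x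
    = kG 1 p x + kG 1 p (x * y)"
proof -
  have "((\<lambda>(m, n). (of_int m ^ 1 * (kc p m * x powi m)) * (of_int n ^ 0 * (kc p n * y powi n)))
      has_sum kS 1 p x * kS 0 p y) UNIV"
    using has_sum_times_complex[OF countableI_type countableI_type kS_sums(1,2)] by (simp only: UNIV_Times_UNIV)
  note L = has_sum_diff[OF has_sum_diff[OF has_sum_diff[OF this
      has_sum_shear1[OF kS_sums(1)[of 0] kS_sums(3)[of 1]]]
      has_sum_shear2[OF kS_sums(2)[of 0] kS_sums(3)[of 1]]]
      has_sum_shear1[OF kS_sums(1)[of 1] kS_sums(3)[of 0]]]
  have "((\<lambda>(m, n). if n = 0 then of_int m * (kg p m * x powi m) else 0) has_sum kG 1 p x) UNIV"
    by (rule has_sum_supported[OF _ kG_sums(1)[of 1], where h = "\<lambda>n. (n, 0)"]) (auto simp: inj_def)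
  moreover have "((\<lambda>(m, n). if m = n then of_int m * (kg p m * (x * y) powi m) else 0) has_sum kG 1 p (x * y)) UNIV"
    by (rule has_sum_supported[OF _ kG_sums(3)[of 1], where h = "\<lambda>n. (n, n)"]) (auto simp: inj_def)
  ultimately have R: "((\<lambda>z. (case z of (m, n) \<Rightarrow> if n = 0 then of_int m * (kg p m * x powi m) else 0)
      + (case z of (m, n) \<Rightarrow> if m = n then of_int m * (kg p m * (x * y) powi m) else 0))
      has_sum kG 1 p x + kG 1 p (x * y)) UNIV"
    by (intro has_sum_add)
  have "kS 1 p x * kS 0 p y - kS 0 p x * kS 1 p (x * y) - kS 0 p y * kS 1 p (x * y)
      - kS 1 p x * kS 0 p (x * y) = kG 1 p x + kG 1 p (x * y)"
  proof (rule has_sum_unique[OF L], rule has_sum_cong[THEN iffD1, OF _ R], goal_cases)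
    case (1 z)
    obtain m n where z: "z = (m, n)" by (cases z)
    have "(of_int m ^ 1 * (kc p m * x powi m)) * (of_int n ^ 0 * (kc p n * y powi n))
      - of_int (m - n) ^ 0 * (kc p (m - n) * x powi (m - n)) * (of_int n ^ 1 * (kc p n * (x * y) powi n))
      - of_int (n - m) ^ 0 * (kc p (n - m) * y powi (n - m)) * (of_int m ^ 1 * (kc p m * (x * y) powi m))
      - of_int (m - n) ^ 1 * (kc p (m - n) * x powi (m - n)) * (of_int n ^ 0 * (kc p n * (x * y) powi n))
      = of_int m * (kc p m * kc p n * x powi m * y powi n
         - kc p n * (x * y) powi n * (kc p (m - n) * x powi (m - n))
         - kc p m * (x * y) powi m * (kc p (n - m) * y powi (n - m)))"
      by (simp add: algebra_simps)
    also note kc_addition_xy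
    finally show ?case
      by (auto simp: z algebra_simps)
  qed
  thus ?thesis by (simp add: algebra_simps)
qed

text \<open>The same summation with weight \<open>m n\<close>, the mixed derivative in
  \<open>x\<close> and \<open>y\<close>. Both axes drop out and the diagonal carries
  \<open>m^2\<close>; \<open>m = n + (m - n)\<close> and \<open>n = m + (n - m)\<close> split the
  two sheared products.\<close>

lemma kS_addition_2:
  "kS 1 p x * kS 1 p y - kS 2 p (x * y) * (kS 0 p x + kS 0 p y)
     - kS 1 p (x * y) * (kS 1 p x + kS 1 p y) = kG 2 p (x * y)"
proof -
  have "((\<lambda>(m, n). (of_int m ^ 1 * (kc p m * x powi m)) * (of_int n ^ 1 * (kc p n * y powi n)))
      has_sum kS 1 p x * kS 1 p y) UNIV"
    using has_sum_times_complex[OF countableI_type countableI_type kS_sums(1,2)] by (simp only: UNIV_Times_UNIV)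
  note L = has_sum_diff[OF has_sum_diff[OF has_sum_diff[OF has_sum_diff[OF this
      has_sum_shear1[OF kS_sums(1)[of 0] kS_sums(3)[of 2]]]
      has_sum_shear2[OF kS_sums(2)[of 0] kS_sums(3)[of 2]]]
      has_sum_shear1[OF kS_sums(1)[of 1] kS_sums(3)[of 1]]]
      has_sum_shear2[OF kS_sums(2)[of 1] kS_sums(3)[of 1]]]
  have R: "((\<lambda>(m, n). if m = n then of_int m ^ 2 * (kg p m * (x * y) powi m) else 0) has_sum kG 2 p (x * y)) UNIV"
    by (rule has_sum_supported[OF _ kG_sums(3)[of 2], where h = "\<lambda>n. (n, n)"]) (auto simp: inj_def)
  have "kS 1 p x * kS 1 p y - kS 0 p x * kS 2 p (x * y) - kS 0 p y * kS 2 p (x * y)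
      - kS 1 p x * kS 1 p (x * y) - kS 1 p y * kS 1 p (x * y) = kG 2 p (x * y)"
  proof (rule has_sum_unique[OF L], rule has_sum_cong[THEN iffD1, OF _ R], goal_cases)
    case (1 z)
    obtain m n where z: "z = (m, n)" by (cases z)
    have "(of_int m ^ 1 * (kc p m * x powi m)) * (of_int n ^ 1 * (kc p n * y powi n))
      - of_int (m - n) ^ 0 * (kc p (m - n) * x powi (m - n)) * (of_int n ^ 2 * (kc p n * (x * y) powi n))
      - of_int (n - m) ^ 0 * (kc p (n - m) * y powi (n - m)) * (of_int m ^ 2 * (kc p m * (x * y) powi m))
      - of_int (m - n) ^ 1 * (kc p (m - n) * x powi (m - n)) * (of_int n ^ 1 * (kc p n * (x * y) powi n))
      - of_int (n - m) ^ 1 * (kc p (n - m) * y powi (n - m)) * (of_int m ^ 1 * (kc p m * (x * y) powi m))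
      = of_int m * of_int n * (kc p m * kc p n * x powi m * y powi n
         - kc p n * (x * y) powi n * (kc p (m - n) * x powi (m - n))
         - kc p m * (x * y) powi m * (kc p (n - m) * y powi (n - m)))"
      by (simp add: algebra_simps power2_eq_square)
    also note kc_addition_xy
    finally show ?case
      by (auto simp: z algebra_simps power2_eq_square)
  qed
  thus ?thesis by (simp add: algebra_simps)
qed

end

text \<open>
  For \<open>N \<noteq> 0\<close> the addition formula turns the convolution into \<open>kc p N\<close> times the series of the
  differences \<open>kc p i - kc p (i - N)\<close>, which telescopes to \<open>N\<close> since \<open>kc p i\<close> tends to \<open>0\<close> at
  \<open>-\<infinity>\<close> and to \<open>1\<close> at \<open>\<infinity>\<close>.
\<close>

lemma kc_convolution:
  fixes p :: complex
  assumes p: "p \<noteq> 0" "norm p < 1"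
  shows "((\<lambda>i. kc p i * kc p (N - i)) has_sum
           (of_int N * kc p N - 2 * kg p N - (if N = 0 then kG 0 p 1 else 0))) UNIV"
proof (cases "N = 0")
  case True
  have "((\<lambda>n. of_int n ^ 0 * (kg p n * 1 powi n)) has_sum kG 0 p 1) UNIV"
    using p by (intro kG_has_sum) auto
  hence "((\<lambda>n. - kg p n) has_sum - kG 0 p 1) UNIV"
    by (intro has_sum_uminusI) simp
  \<comment> \<open>For \<open>n \<noteq> 0\<close> the summand is \<open>- kg p n\<close>. At
    \<open>n = 0\<close> it is \<open>1 / 4\<close>, whereas \<open>- kg p 0 = 1 / 12\<close>; the
    difference is \<open>1 / 6\<close>.\<close>
  moreover have "((\<lambda>n. if n = (0::int) then 1 / 6 else 0) has_sum (1 / 6 :: complex)) UNIV"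
    by (rule has_sum_finite_neutralI[of "{0}"]) auto
  ultimately have "((\<lambda>n. - kg p n + (if n = 0 then 1 / 6 else 0)) has_sum - kG 0 p 1 + 1 / 6) UNIV"
    by (rule has_sum_add)
  also have "(\<lambda>n. - kg p n + (if n = 0 then 1 / 6 else 0)) = (\<lambda>n. kc p n * kc p (0 - n))"
    using kg_eq[OF p] by (auto simp: fun_eq_iff kg_def[of p 0] kc_def[of p 0])
  finally show ?thesis using True by (simp add: kg_def[of p 0])
next
  case False
  \<comment> \<open>Neither \<open>kc p i\<close> nor its shift is summable. Subtracting the step
    function leaves a family decaying in both directions, whose unknown sum \<open>D\<close> cancels
    against that of its shift.\<close>
  define d where "d = (\<lambda>i. kc p i - (if i \<ge> 0 then 1 else 0))"
  have "norm (d i) \<le> 1 / (1 - norm p) * norm p ^ nat \<bar>i\<bar>" for i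
  proof -
    consider "i = 0" | "i > 0" | "i < 0" by linarith
    thus ?thesis
    proof cases
      case 1
      thus ?thesis using p by (simp add: d_def kc_def field_simps)
    next
      case 2
      have "p ^ nat i \<noteq> 1" using powi_neq_1[OF p, of i] 2 by (simp add: power_int_def)
      hence "d i = 1 / (1 - p ^ nat i) * p ^ nat i"
        using 2 by (simp add: d_def kc_def power_int_def divide_simps)
      hence "norm (d i) = norm (1 / (1 - p ^ nat i)) * norm p ^ nat i"
        by (simp only: norm_mult norm_power)
      also have "\<dots> \<le> 1 / (1 - norm p) * norm p ^ nat i"
        using 2 p by (intro mult_right_mono norm_inverse_one_minus_power_le) auto
      finally show ?thesis using 2 by simp
    next
      case 3
      define m where "m = nat (-i)"
      have m: "m > 0" "i = - int m" using 3 by (auto simp: m_def)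
      have "p ^ m \<noteq> 1" using powi_neq_1[OF p, of "int m"] m by simp
      hence "d i = - (1 / (1 - p ^ m) * p ^ m)"
        using m p by (simp add: d_def kc_def power_int_minus divide_simps) (simp add: algebra_simps)
      hence "norm (d i) = norm (1 / (1 - p ^ m)) * norm p ^ m"
        by (simp only: norm_mult norm_power norm_minus_cancel)
      also have "\<dots> \<le> 1 / (1 - norm p) * norm p ^ m"
        using m p by (intro mult_right_mono norm_inverse_one_minus_power_le) auto
      finally show ?thesis using m by simp
    qed
  qed
  hence "(\<lambda>i. of_int i ^ 0 * d i) summable_on UNIV"
    using p by (intro abs_summable_int_geometric[of "norm p" _ "1 / (1 - norm p)"]) auto
  then obtain D where D: "(d has_sum D) UNIV"
    by (auto simp: summable_on_def)
  have D': "((\<lambda>i. d (i - N)) has_sum D) UNIV"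
    using D by (subst has_sum_reindex_bij_witness[of _ "\<lambda>i. i + N" "\<lambda>i. i - N" _ d]) auto
  have I: "((\<lambda>i::int. (if i \<ge> 0 then 1 else 0) - (if i \<ge> N then 1 else 0)) has_sum (of_int N :: complex)) UNIV"
  proof (cases "N > 0")
    case True
    have "(\<Sum>i\<in>{0..<N}. (if i \<ge> 0 then 1 else 0) - (if i \<ge> N then 1 else 0)) = (\<Sum>i\<in>{0..<N}. (1::complex))"
      by (intro sum.cong) auto
    thus ?thesis using True
      by (intro has_sum_finite_neutralI[of "{0..<N}"]) auto
  next
    case N: False
    have "(\<Sum>i\<in>{N..<0}. (if i \<ge> 0 then 1 else 0) - (if i \<ge> N then 1 else 0)) = (\<Sum>i\<in>{N..<0}. (-1::complex))"
      by (intro sum.cong) auto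
    thus ?thesis using N
      by (intro has_sum_finite_neutralI[of "{N..<0}"]) auto
  qed
  \<comment> \<open>At \<open>i = 0\<close> and at \<open>i = N\<close> the addition formula has the
    correction \<open>kg p N\<close>, whence the total \<open>- 2 * kg p N\<close>.\<close>
  have E: "((\<lambda>i. if i = 0 \<or> i = N then - kg p N else 0) has_sum - 2 * kg p N) UNIV"
    by (rule has_sum_finite_neutralI[of "{0, N}"]) (use False in auto)
  have "((\<lambda>i. kc p N * (d i - d (i - N) + ((if i \<ge> 0 then 1 else 0) - (if i \<ge> N then 1 else 0)))
      + (if i = 0 \<or> i = N then - kg p N else 0)) has_sum kc p N * (D - D + of_int N) + - 2 * kg p N) UNIV"
    by (intro has_sum_add[OF has_sum_cmult_right] has_sum_add has_sum_diff D D' I E)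
  moreover have "kc p N * (d i - d (i - N) + ((if i \<ge> 0 then 1 else 0) - (if i \<ge> N then 1 else 0)))
      + (if i = 0 \<or> i = N then - kg p N else 0) = kc p i * kc p (N - i)" for i
  proof -
    have d: "d i - d (i - N) + ((if i \<ge> 0 then 1 else 0) - (if i \<ge> N then 1 else 0)) = kc p i - kc p (i - N)"
      by (simp add: d_def)
    have neg: "kc p (N - i) = 1 - kc p (i - N)"
      using kc_eq_neg[OF p, of "i - N"] by simp
    have 0: "kc p 0 = 1 / 2" by (simp add: kc_def)
    have g: "kg p N = - kc p N * (1 - kc p N)"
      using kg_eq[OF p False] kc_eq_neg[OF p] by simp
    consider "i = 0" | "i = N" | "i \<noteq> 0" "i \<noteq> N" by blast
    thus ?thesis
    proof cases
      case 1
      have n: "kc p (- N) = 1 - kc p N" by (rule kc_eq_neg[OF p])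
      show ?thesis unfolding d by (simp add: 0 1 g n algebra_simps)
    next
      case 2
      show ?thesis unfolding d by (simp add: 0 2 g algebra_simps)
    next
      case 3
      have "kc p i * kc p N - kc p N * kc p (i - N) - kc p i * kc p (N - i) = 0"
        using kc_addition[OF p, of i N] 3 False by simp
      thus ?thesis unfolding d using 3 by (simp add: algebra_simps)
    qed
  qed
  ultimately show ?thesis using False by (simp add: mult.commute)
qed

section \<open>The square formula and the reflection of \<open>z\<close> to
  \<open>p / z\<close>\<close>

context
  fixes p z :: complex
  assumes p: "p \<noteq> 0" and z: "norm p < norm z" "norm z < 1"
begin

text \<open>The product of two series at \<open>z\<close> is summed along the lines
  \<open>m + n = N\<close>, where the weight and the power of \<open>z\<close> are constant; the
  inner sums are given by \<open>kc_convolution\<close>.\<close>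

lemma kS_product_has_sum:
  "((\<lambda>N. of_int N ^ j * (of_int N * kc p N - 2 * kg p N - (if N = 0 then kG 0 p 1 else 0)) * z powi N)
     has_sum S) UNIV"
  if S: "((\<lambda>(m, n). of_int (m + n) ^ j * ((kc p m * z powi m) * (kc p n * z powi n))) has_sum S) UNIV"
proof -
  have [simp]: "z \<noteq> 0" using z by auto
  have p1: "norm p < 1" using z by auto
  have "((\<lambda>(N, i). of_int N ^ j * ((kc p i * z powi i) * (kc p (N - i) * z powi (N - i)))) has_sum S) UNIV"
    using S by (subst has_sum_reindex_bij_witness[of _ "\<lambda>(m, n). (m + n, m)" "\<lambda>(N, i). (i, N - i)" UNIV "\<lambda>(m, n). of_int (m + n) ^ j * ((kc p m * z powi m) * (kc p n * z powi n))"]) auto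
  hence "((\<lambda>(N, i). of_int N ^ j * ((kc p i * z powi i) * (kc p (N - i) * z powi (N - i)))) has_sum S)
      (Sigma UNIV (\<lambda>_. UNIV))" by simp
  thus ?thesis
  proof (rule has_sum_SigmaD)
    fix N :: int
    have "z powi i * z powi (N - i) = z powi N" for i
      by (simp flip: power_int_add)
    hence "(\<lambda>i. of_int N ^ j * z powi N * (kc p i * kc p (N - i)))
      = (\<lambda>i. case (N, i) of (N, i) \<Rightarrow> of_int N ^ j * ((kc p i * z powi i) * (kc p (N - i) * z powi (N - i))))"
      by (auto simp: fun_eq_iff algebra_simps)
    moreover have "((\<lambda>i. of_int N ^ j * z powi N * (kc p i * kc p (N - i))) has_sum
      of_int N ^ j * z powi N * (of_int N * kc p N - 2 * kg p N - (if N = 0 then kG 0 p 1 else 0))) UNIV"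
      by (intro has_sum_cmult_right kc_convolution p p1)
    ultimately show "((\<lambda>i. case (N, i) of (N, i) \<Rightarrow> of_int N ^ j * ((kc p i * z powi i) * (kc p (N - i) * z powi (N - i))))
      has_sum of_int N ^ j * (of_int N * kc p N - 2 * kg p N - (if N = 0 then kG 0 p 1 else 0)) * z powi N) UNIV"
      by (simp add: mult_ac)
  qed
qed

lemma square_bounds: "norm p < 1" "norm (p * z) < 1"
  using z by (auto simp: norm_mult) (smt (verit) mult_left_le norm_ge_zero)

text \<open>In the convolution, the part \<open>of_int N * kc p N\<close> produces the derivative
  \<open>kS 1\<close>, and the exceptional value at \<open>N = 0\<close> produces the constant
  \<open>kG 0 p 1\<close>, through which \<open>E2 p\<close> enters.\<close>

lemma kS_square: "kS 0 p z ^ 2 = kS 1 p z - 2 * kG 0 p z - kG 0 p 1"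
proof -
  have "((\<lambda>(m, n). of_int (m + n) ^ 0 * ((kc p m * z powi m) * (kc p n * z powi n)))
      has_sum kS 0 p z * kS 0 p z) UNIV"
    using has_sum_times_complex[OF countableI_type countableI_type kS_has_sum[of p z 0] kS_has_sum[of p z 0]] p z by simp
  hence "((\<lambda>N. of_int N ^ 0 * (of_int N * kc p N - 2 * kg p N - (if N = 0 then kG 0 p 1 else 0)) * z powi N)
     has_sum kS 0 p z * kS 0 p z) UNIV"
    by (rule kS_product_has_sum)
  moreover have "((\<lambda>N. of_int N ^ 1 * (kc p N * z powi N) - 2 * (of_int N ^ 0 * (kg p N * z powi N))
      - (if N = 0 then kG 0 p 1 else 0)) has_sum kS 1 p z - 2 * kG 0 p z - kG 0 p 1) UNIV"
    using p z square_bounds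
    by (intro has_sum_diff has_sum_cmult_right kS_has_sum kG_has_sum has_sum_finite_neutralI[of "{0}"]) auto
  moreover have "(\<lambda>N. of_int N ^ 0 * (of_int N * kc p N - 2 * kg p N - (if N = 0 then kG 0 p 1 else 0)) * z powi N)
      = (\<lambda>N. of_int N ^ 1 * (kc p N * z powi N) - 2 * (of_int N ^ 0 * (kg p N * z powi N))
      - (if N = 0 then kG 0 p 1 else 0))"
    by (auto simp: fun_eq_iff algebra_simps)
  ultimately show ?thesis
    using has_sum_unique by (fastforce simp: power2_eq_square)
qed

text \<open>This is \<open>z d/dz\<close> of \<open>kS_square\<close>: the weight
  \<open>m + n\<close> splits by the product rule on one side and annihilates the constant term on
  the other.\<close>

lemma kS_square_deriv: "2 * kS 0 p z * kS 1 p z = kS 2 p z - 2 * kG 1 p z"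
proof -
  have "((\<lambda>(m, n). (of_int m ^ 1 * (kc p m * z powi m)) * (of_int n ^ 0 * (kc p n * z powi n)))
      has_sum kS 1 p z * kS 0 p z) UNIV"
    using has_sum_times_complex[OF countableI_type countableI_type kS_has_sum[of p z 1] kS_has_sum[of p z 0]] p z by simp
  moreover have "((\<lambda>(m, n). (of_int m ^ 0 * (kc p m * z powi m)) * (of_int n ^ 1 * (kc p n * z powi n)))
      has_sum kS 0 p z * kS 1 p z) UNIV"
    using has_sum_times_complex[OF countableI_type countableI_type kS_has_sum[of p z 0] kS_has_sum[of p z 1]] p z by simp
  ultimately have "((\<lambda>w. (case w of (m, n) \<Rightarrow> (of_int m ^ 1 * (kc p m * z powi m)) * (of_int n ^ 0 * (kc p n * z powi n)))
     + (case w of (m, n) \<Rightarrow> (of_int m ^ 0 * (kc p m * z powi m)) * (of_int n ^ 1 * (kc p n * z powi n))))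
      has_sum kS 1 p z * kS 0 p z + kS 0 p z * kS 1 p z) UNIV"
    by (rule has_sum_add)
  also have "(\<lambda>w. (case w of (m, n) \<Rightarrow> (of_int m ^ 1 * (kc p m * z powi m)) * (of_int n ^ 0 * (kc p n * z powi n)))
     + (case w of (m, n) \<Rightarrow> (of_int m ^ 0 * (kc p m * z powi m)) * (of_int n ^ 1 * (kc p n * z powi n))))
     = (\<lambda>(m, n). of_int (m + n) ^ 1 * ((kc p m * z powi m) * (kc p n * z powi n)))"
    by (auto simp: fun_eq_iff algebra_simps)
  finally have "((\<lambda>N. of_int N ^ 1 * (of_int N * kc p N - 2 * kg p N - (if N = 0 then kG 0 p 1 else 0)) * z powi N)
     has_sum kS 1 p z * kS 0 p z + kS 0 p z * kS 1 p z) UNIV"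
    by (rule kS_product_has_sum)
  moreover have "((\<lambda>N. of_int N ^ 2 * (kc p N * z powi N) - 2 * (of_int N ^ 1 * (kg p N * z powi N)))
      has_sum kS 2 p z - 2 * kG 1 p z) UNIV"
    using p z square_bounds
    by (intro has_sum_diff has_sum_cmult_right kS_has_sum kG_has_sum) auto
  moreover have "(\<lambda>N. of_int N ^ 1 * (of_int N * kc p N - 2 * kg p N - (if N = 0 then kG 0 p 1 else 0)) * z powi N)
      = (\<lambda>N. of_int N ^ 2 * (kc p N * z powi N) - 2 * (of_int N ^ 1 * (kg p N * z powi N)))"
    by (auto simp: fun_eq_iff algebra_simps power2_eq_square)
  ultimately have "kS 1 p z * kS 0 p z + kS 0 p z * kS 1 p z = kS 2 p z - 2 * kG 1 p z"
    using has_sum_unique by simp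
  thus ?thesis by (simp add: algebra_simps)
qed

lemma reflection_bounds: "norm p < norm (p / z)" "norm (p / z) < 1" "norm (p * (p / z)) < 1"
proof -
  show 1: "norm p < norm (p / z)" "norm (p / z) < 1"
    using z p less_divide_eq[of "norm p" "norm p" "norm z"] by (auto simp: norm_divide divide_less_eq)
  have "norm (p * (p / z)) \<le> norm (p / z)"
    using square_bounds(1) unfolding norm_mult by (intro mult_left_le_one_le) auto
  thus "norm (p * (p / z)) < 1" using 1 by linarith
qed

lemma reflect_has_sum:
  fixes f :: "int \<Rightarrow> complex"
  shows "(f has_sum S) UNIV \<Longrightarrow> ((\<lambda>n. f (-n)) has_sum S) UNIV"
  by (subst has_sum_reindex_bij_witness[of _ uminus uminus _ f]) auto

text \<open>For \<open>a = p^n\<close> the reflected coefficient is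
  \<open>1 / (1 - 1/a) * 1/a = - 1 / (1 - a)\<close>. The term \<open>1\<close> at
  \<open>n = 0\<close> restores \<open>1 / 2 = 1 - 1 / 2\<close>.\<close>

lemma kc_reflect: "kc p (-n) * (p / z) powi (-n) = (if n = 0 then 1 else 0) - kc p n * z powi n"
proof (cases "n = 0")
  case False
  have [simp]: "z \<noteq> 0" using z by auto
  define a where "a = p powi n"
  have a: "a \<noteq> 0" "a \<noteq> 1" "1 - a \<noteq> 0" "a - 1 \<noteq> 0"
    using powi_neq_1[of p n] p False square_bounds by (auto simp: a_def)
  have "1 / (1 - inverse a) * inverse a = - (1 / (1 - a))"
    using a by (simp add: divide_simps)
  hence "1 / (1 - inverse a) * inverse a * z powi n = - (1 / (1 - a)) * z powi n" by simp
  moreover have "(p / z) powi (-n) = inverse a * z powi n"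
    by (simp only: a_def power_int_minus power_int_divide_distrib) (simp add: divide_inverse mult.commute)
  ultimately show ?thesis using False by (simp add: kc_def power_int_minus a_def mult.assoc)
qed (simp add: kc_def)

text \<open>For \<open>a = p^n\<close> the reflected coefficient is
  \<open>1 / (1 - a)^2 = a / (1 - a)^2 + 1 / (1 - a)\<close>. At \<open>n = 0\<close> the surplus
  \<open>kc p 0 = 1 / 2\<close> has to be taken off.\<close>

lemma kg_reflect: "kg p (-n) * (p / z) powi (-n) = kg p n * z powi n + kc p n * z powi n - (if n = 0 then 1 / 2 else 0)"
proof (cases "n = 0")
  case False
  have [simp]: "z \<noteq> 0" using z by auto
  define a where "a = p powi n"
  have a: "a \<noteq> 0" "a \<noteq> 1" "1 - a \<noteq> 0" "a - 1 \<noteq> 0"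
    using powi_neq_1[of p n] p False square_bounds by (auto simp: a_def)
  have "inverse a / (1 - inverse a)^2 * inverse a = a / (1 - a)^2 + 1 / (1 - a)"
    using a by (simp add: divide_simps power2_eq_square) (simp add: algebra_simps)
  hence "inverse a / (1 - inverse a)^2 * inverse a * z powi n = (a / (1 - a)^2 + 1 / (1 - a)) * z powi n" by simp
  moreover have "(p / z) powi (-n) = inverse a * z powi n"
    by (simp only: a_def power_int_minus power_int_divide_distrib) (simp add: divide_inverse mult.commute)
  ultimately show ?thesis using False
    by (simp add: kc_def kg_def power_int_minus a_def mult.assoc distrib_right)
qed (simp add: kc_def kg_def)

lemma kS_0_reflect: "kS 0 p (p / z) = 1 - kS 0 p z"
proof -
  have "((\<lambda>n. of_int (-n) ^ 0 * (kc p (-n) * (p / z) powi (-n))) has_sum kS 0 p (p / z)) UNIV"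
    using p reflection_bounds by (intro reflect_has_sum kS_has_sum) auto
  moreover have "((\<lambda>n. (if n = 0 then 1 else 0) - of_int n ^ 0 * (kc p n * z powi n)) has_sum 1 - kS 0 p z) UNIV"
    using p z by (intro has_sum_diff kS_has_sum has_sum_finite_neutralI[of "{0}"]) auto
  ultimately show ?thesis using has_sum_unique by (fastforce simp: kc_reflect)
qed

lemma kS_1_reflect: "kS 1 p (p / z) = kS 1 p z"
proof -
  have "((\<lambda>n. of_int (-n) ^ 1 * (kc p (-n) * (p / z) powi (-n))) has_sum kS 1 p (p / z)) UNIV"
    using p reflection_bounds by (intro reflect_has_sum kS_has_sum) auto
  moreover have "((\<lambda>n. of_int n ^ 1 * (kc p n * z powi n)) has_sum kS 1 p z) UNIV"
    using p z by (intro kS_has_sum) auto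
  moreover have "(\<lambda>n. of_int (-n) ^ 1 * (kc p (-n) * (p / z) powi (-n))) = (\<lambda>n. of_int n ^ 1 * (kc p n * z powi n))"
    unfolding kc_reflect by (auto simp: fun_eq_iff)
  ultimately show ?thesis using has_sum_unique by simp
qed

lemma kG_0_reflect: "kG 0 p (p / z) = kG 0 p z + kS 0 p z - 1 / 2"
proof -
  have "((\<lambda>n. of_int (-n) ^ 0 * (kg p (-n) * (p / z) powi (-n))) has_sum kG 0 p (p / z)) UNIV"
    using p reflection_bounds square_bounds by (intro reflect_has_sum kG_has_sum) auto
  moreover have "((\<lambda>n. of_int n ^ 0 * (kg p n * z powi n) + of_int n ^ 0 * (kc p n * z powi n) - (if n = 0 then 1 / 2 else 0))
      has_sum kG 0 p z + kS 0 p z - 1 / 2) UNIV"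
    using p z square_bounds by (intro has_sum_diff has_sum_add kG_has_sum kS_has_sum has_sum_finite_neutralI[of "{0}"]) auto
  ultimately show ?thesis using has_sum_unique by (fastforce simp: kg_reflect)
qed

lemma kG_1_reflect: "kG 1 p (p / z) = - (kG 1 p z + kS 1 p z)"
proof -
  have "((\<lambda>n. of_int (-n) ^ 1 * (kg p (-n) * (p / z) powi (-n))) has_sum kG 1 p (p / z)) UNIV"
    using p reflection_bounds square_bounds by (intro reflect_has_sum kG_has_sum) auto
  moreover have "((\<lambda>n. - (of_int n ^ 1 * (kg p n * z powi n) + of_int n ^ 1 * (kc p n * z powi n)))
      has_sum - (kG 1 p z + kS 1 p z)) UNIV"
    using p z square_bounds by (intro has_sum_uminusI has_sum_add kG_has_sum kS_has_sum) auto
  moreover have "(\<lambda>n. of_int (-n) ^ 1 * (kg p (-n) * (p / z) powi (-n))) =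
     (\<lambda>n. - (of_int n ^ 1 * (kg p n * z powi n) + of_int n ^ 1 * (kc p n * z powi n)))"
    unfolding kg_reflect by (auto simp: fun_eq_iff algebra_simps)
  ultimately show ?thesis using has_sum_unique by simp
qed

end

section \<open>Lambert series on the unit disc\<close>

text \<open>Pairing \<open>n\<close> with \<open>- n\<close> folds a bilateral series into a series
  over the positive integers, apart from the term at \<open>0\<close>. This is the passage to
  Lambert series that make sense at \<open>q = 0\<close>.\<close>

lemma has_sum_int_imp_sums:
  fixes f :: "int \<Rightarrow> complex"
  assumes "(f has_sum S) UNIV"
  shows "(\<lambda>n. f (int (Suc n)) + f (- int (Suc n))) sums (S - f 0)"
proof -
  let ?P = "range (\<lambda>n. int (Suc n))" and ?N = "range (\<lambda>n. - int (Suc n))"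
  have "f summable_on UNIV" using assms has_sum_imp_summable by blast
  hence "f summable_on ?P" "f summable_on ?N"
    using summable_on_subset_banach by blast+
  then obtain a b where ab: "(f has_sum a) ?P" "(f has_sum b) ?N"
    by (auto simp: summable_on_def)
  have "(f has_sum (a + b)) (?P \<union> ?N)"
    by (rule has_sum_Un_disjoint[OF ab]) auto
  moreover have "(f has_sum f 0) {0}"
    using has_sum_finite[of "{0}" f] by simp
  ultimately have "(f has_sum (a + b + f 0)) ((?P \<union> ?N) \<union> {0})"
    by (rule has_sum_Un_disjoint) auto
  moreover have "(?P \<union> ?N) \<union> {0} = UNIV"
  proof -
    have "x \<in> ?P \<union> ?N \<union> {0}" for x
    proof -
      consider "x = 0" | "x = int (Suc (nat (x - 1)))" | "x = - int (Suc (nat (- x - 1)))"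
        by linarith
      thus ?thesis by cases blast+
    qed
    thus ?thesis by auto
  qed
  ultimately have "a + b + f 0 = S" using assms has_sum_unique by auto
  moreover have "(\<lambda>n. f (int (Suc n))) sums a"
    using ab(1) by (intro has_sum_imp_sums) (subst (asm) has_sum_reindex, auto simp: inj_def o_def)
  moreover have "(\<lambda>n. f (- int (Suc n))) sums b"
    using ab(2) by (intro has_sum_imp_sums) (subst (asm) has_sum_reindex, auto simp: inj_def o_def)
  ultimately show ?thesis using sums_add by (force simp: algebra_simps)
qed

text \<open>The majorant is a product of two convergent series in one variable, so the double series
  converges absolutely and both iterated sums agree. The factor \<open>Suc j\<close> leaves room for
  the weights in \<open>E2\<close>.\<close>

lemma double_series_swap:
  fixes f :: "nat \<Rightarrow> nat \<Rightarrow> complex"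
  assumes r: "0 \<le> r" "r < 1" and bound: "\<And>j n. norm (f j n) \<le> real (Suc j) * r ^ j * r ^ n"
    and a: "\<And>j. f j sums a j" and b: "\<And>n. (\<lambda>j. f j n) sums b n"
  obtains S where "a sums S" "b sums S"
proof -
  have sr: "summable (\<lambda>n. r ^ n)" using r by (simp add: summable_geometric)
  have sr': "summable (\<lambda>n. real (Suc n) * r ^ n)"
    using summable_add[OF summable_poly_geometric[of r 1] summable_poly_geometric[of r 0]] r
    by (simp add: algebra_simps)
  have 1: "((\<lambda>n. of_real (r ^ n)) has_sum (\<Sum>n. of_real (r ^ n) :: complex)) UNIV"
    using sr r by (intro norm_summable_imp_has_sum summable_sums summable_of_real)
      (simp_all add: norm_power del: of_real_power)
  have 2: "((\<lambda>n. of_real (real (Suc n) * r ^ n)) has_sum (\<Sum>n. of_real (real (Suc n) * r ^ n) :: complex)) UNIV"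
    using sr' r by (intro norm_summable_imp_has_sum summable_sums summable_of_real) (simp_all only: norm_of_real abs_mult abs_of_nonneg of_nat_0_le_iff zero_le_power)
  have "(\<lambda>(j, n). of_real (real (Suc j) * r ^ j) * of_real (r ^ n) :: complex) summable_on (UNIV \<times> UNIV)"
    using has_sum_times_complex[OF countableI_type countableI_type 2 1] has_sum_imp_summable by blast
  hence "(\<lambda>z. norm ((\<lambda>(j, n). of_real (real (Suc j) * r ^ j) * of_real (r ^ n) :: complex) z)) summable_on (UNIV \<times> UNIV)"
    using summable_on_iff_abs_summable_on_complex by blast
  hence "(\<lambda>z. norm ((\<lambda>(j, n). f j n) z)) summable_on (UNIV \<times> UNIV)"
  proof (rule Infinite_Sum.abs_summable_on_comparison_test)
    fix z :: "nat \<times> nat"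
    obtain j n where z: "z = (j, n)" by (cases z)
    show "norm (case z of (j, n) \<Rightarrow> f j n) \<le> norm ((\<lambda>(j, n). of_real (real (Suc j) * r ^ j) * of_real (r ^ n) :: complex) z)"
      using bound[of j n] r unfolding z prod.case norm_mult norm_of_real by (simp add: abs_mult)
  qed
  then obtain S where S: "((\<lambda>(j, n). f j n) has_sum S) (UNIV \<times> UNIV)"
    using abs_summable_summable has_sum_infsum by blast
  have "(a has_sum S) UNIV"
  proof (rule has_sum_SigmaD[OF S])
    fix j
    have "summable (\<lambda>n. norm (f j n))"
      by (rule summable_comparison_test[OF _ summable_mult[OF sr, of "real (Suc j) * r ^ j"]]) (use bound in auto)
    thus "((\<lambda>n. case (j, n) of (j, n) \<Rightarrow> f j n) has_sum a j) UNIV"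
      using a by (auto intro: norm_summable_imp_has_sum)
  qed
  moreover have "((\<lambda>(n, j). f j n) has_sum S) (UNIV \<times> UNIV)"
    using S by (subst has_sum_reindex_bij_witness[of _ "\<lambda>(n, j). (j, n)" "\<lambda>(n, j). (j, n)" _ "\<lambda>(j, n). f j n"]) auto
  hence "(b has_sum S) UNIV"
  proof (rule has_sum_SigmaD)
    fix n
    have "summable (\<lambda>j. norm (f j n))"
      by (rule summable_comparison_test[OF _ summable_mult2[OF sr', of "r ^ n"]]) (use bound in auto)
    thus "((\<lambda>j. case (n, j) of (n, j) \<Rightarrow> f j n) has_sum b n) UNIV"
      using b by (auto intro: norm_summable_imp_has_sum)
  qed
  ultimately show ?thesis using that has_sum_imp_sums by blast
qed

lemma norm_power_times_le:
  fixes q :: complex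
  assumes "norm q \<le> r" "r < 1" "k > 0"
  shows "norm (q ^ (k * Suc n)) \<le> r ^ Suc n"
proof -
  have "norm q ^ (k * Suc n) \<le> norm q ^ Suc n"
    using assms mult_le_mono1[of 1 k "Suc n"] by (intro power_decreasing) auto
  also have "\<dots> \<le> r ^ Suc n" using assms by (intro power_mono) auto
  finally show ?thesis by (simp only: norm_power)
qed

lemma power_neq_1:
  fixes q :: complex
  assumes "norm q < 1" "n > 0"
  shows "1 - q ^ n \<noteq> 0"
proof
  assume "1 - q ^ n = 0"
  hence "norm q ^ n = 1" by (simp flip: norm_power)
  moreover have "norm q ^ n < 1" using assms by (simp add: power_less_one_iff)
  ultimately show False by simp
qed

text \<open>Geometric expansion of \<open>j p^j / (1 - p^j)\<close> gives the double series of
  \<open>j p^(j m)\<close>; summing over \<open>j\<close> first yields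
  \<open>p^m / (1 - p^m)^2\<close>.\<close>

lemma E2_sums:
  assumes p: "norm p < 1"
  shows "(\<lambda>n. p ^ Suc n / (1 - p ^ Suc n) ^ 2) sums ((1 - E2 p) / 24)"
proof -
  have 1: "norm (of_nat (Suc j) * p ^ (Suc j * Suc n)) \<le> real (Suc j) * norm p ^ j * norm p ^ n" for j n
  proof -
    have "norm p ^ (Suc j * Suc n) \<le> norm p ^ (j + n)"
      using p by (intro power_decreasing) auto
    thus ?thesis
      by (simp only: norm_mult norm_of_nat norm_power power_add mult.assoc mult_left_mono of_nat_0_le_iff)
  qed
  have 2: "(\<lambda>n. of_nat (Suc j) * p ^ (Suc j * Suc n)) sums (of_nat (Suc j) * p ^ Suc j / (1 - p ^ Suc j))" for j
  proof -
    have "norm (p ^ Suc j) < 1"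
      using p by (simp only: norm_power power_less_one_iff norm_ge_zero) simp
    from sums_mult[OF geometric_sums[OF this], of "of_nat (Suc j) * p ^ Suc j"]
    have "(\<lambda>n. of_nat (Suc j) * p ^ Suc j * (p ^ Suc j) ^ n) sums (of_nat (Suc j) * p ^ Suc j / (1 - p ^ Suc j))"
      by simp
    thus ?thesis by (simp only: power_mult power_Suc[of "p ^ Suc j"] mult.assoc)
  qed
  have 3: "(\<lambda>j. of_nat (Suc j) * p ^ (Suc j * Suc n)) sums (p ^ Suc n / (1 - p ^ Suc n) ^ 2)" for n
  proof -
    have "norm (p ^ Suc n) < 1"
      using p by (simp only: norm_power power_less_one_iff norm_ge_zero) simp
    from sums_mult[OF geometric_deriv_sums[OF this], of "p ^ Suc n"]
    have "(\<lambda>j. p ^ Suc n * (of_nat (Suc j) * (p ^ Suc n) ^ j)) sums (p ^ Suc n / (1 - p ^ Suc n) ^ 2)"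
      by simp
    also have "(\<lambda>j. p ^ Suc n * (of_nat (Suc j) * (p ^ Suc n) ^ j)) = (\<lambda>j. of_nat (Suc j) * p ^ (Suc j * Suc n))"
    proof
      fix j
      have "p ^ (Suc j * Suc n) = p ^ Suc n * (p ^ Suc n) ^ j"
        by (simp only: mult.commute[of "Suc j"] power_mult power_Suc)
      thus "p ^ Suc n * (of_nat (Suc j) * (p ^ Suc n) ^ j) = of_nat (Suc j) * p ^ (Suc j * Suc n)"
        by (simp only: mult.left_commute)
    qed
    finally show ?thesis .
  qed
  obtain S where S: "(\<lambda>j. of_nat (Suc j) * p ^ Suc j / (1 - p ^ Suc j)) sums S"
      "(\<lambda>n. p ^ Suc n / (1 - p ^ Suc n) ^ 2) sums S"
    by (rule double_series_swap[OF norm_ge_zero p 1 2 3])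
  have "E2 p = 1 - 24 * S"
    unfolding E2_def using S(1) by (simp only: sums_unique[symmetric])
  thus ?thesis using S(2) by simp
qed

text \<open>The summation runs over \<open>m = n + 1\<close>, with \<open>w n\<close> as the weight
  of \<open>m\<close>. The weights \<open>1 / m\<close>, \<open>1\<close> and \<open>m\<close> give
  the logarithms of the infinite products and the one-sided halves of \<open>kS 0\<close> and
  \<open>kS 1\<close>.\<close>

definition lamb :: "(nat \<Rightarrow> complex) \<Rightarrow> nat \<Rightarrow> nat \<Rightarrow> complex \<Rightarrow> complex" where
  "lamb w k d q = (\<Sum>n. w n * q ^ (k * Suc n) / (1 - q ^ (d * Suc n)))"

lemma lamb_0: "k > 0 \<Longrightarrow> lamb w k d 0 = 0"
  by (simp add: lamb_def zero_power del: mult_Suc_right)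

text \<open>Termwise differentiation under a locally uniform majorant. The derivative series is
  stated for \<open>q * D\<close>, which keeps all exponents multiples of \<open>Suc n\<close>; the
  value at \<open>q = 0\<close>, lost in this form, is recorded separately.\<close>

lemma lamb_deriv:
  assumes kd: "k > 0" "d > 0" and w: "\<And>n. norm (w n) \<le> real (Suc n)" and q: "norm q < 1"
  obtains D where "(lamb w k d has_field_derivative D) (at q)"
    "(\<lambda>n. w n * q ^ (k * Suc n) / (1 - q ^ (d * Suc n))) sums lamb w k d q"
    "(\<lambda>n. w n * of_nat (Suc n) * (of_nat k * q ^ (k * Suc n) / (1 - q ^ (d * Suc n))
        + of_nat d * (q ^ (k * Suc n) * q ^ (d * Suc n)) / (1 - q ^ (d * Suc n)) ^ 2)) sums (q * D)"
    "q = 0 \<Longrightarrow> D = (if k = 1 then w 0 else 0)"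
proof -
  define f where "f = (\<lambda>n q. w n * q ^ (k * Suc n) / (1 - q ^ (d * Suc n)))"
  define f' where "f' = (\<lambda>n q. w n * (of_nat (k * Suc n) * q ^ (k * Suc n - 1) / (1 - q ^ (d * Suc n))
      + q ^ (k * Suc n) * (of_nat (d * Suc n) * q ^ (d * Suc n - 1)) / (1 - q ^ (d * Suc n)) ^ 2))"
  have "\<exists>g g'. \<forall>x\<in>ball 0 1. ((\<lambda>n. f n x) sums g x) \<and> ((\<lambda>n. f' n x) sums g' x) \<and> (g has_field_derivative g' x) (at x)"
  proof (rule series_and_derivative_comparison_complex)
    fix n :: nat and x :: complex assume "x \<in> ball 0 1"
    hence nz: "1 - x ^ (d * Suc n) \<noteq> 0" using kd by (intro power_neq_1) auto
    define e where "e = d * Suc n"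
    define l where "l = k * Suc n"
    show "(f n has_field_derivative f' n x) (at x)"
      using nz unfolding f_def f'_def e_def[symmetric] l_def[symmetric]
      by (auto intro!: derivative_eq_intros simp: power2_eq_square divide_simps) (simp add: algebra_simps)
  next
    fix x :: complex assume x: "x \<in> ball 0 1"
    \<comment> \<open>The midpoint between \<open>norm x\<close> and \<open>1\<close>: all points
      within \<open>r - norm x\<close> of \<open>x\<close> have norm at most
      \<open>r < 1\<close>.\<close>
    define r where "r = (1 + norm x) / 2"
    have r: "norm x < r" "r < 1" "0 \<le> r" using x by (auto simp: r_def)
    define h where "h = (\<lambda>n. of_real (real (Suc n) * r ^ Suc n * (1 / (1 - r))) :: complex)"
    have "summable (\<lambda>n. real (Suc n) ^ 1 * r ^ Suc n)"
      by (subst summable_Suc_iff, rule summable_poly_geometric) (use r in auto)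
    hence "summable h"
      unfolding h_def by (intro summable_of_real summable_mult2) simp
    moreover have "range h \<subseteq> \<real>\<^sub>\<ge>\<^sub>0"
      using r by (auto simp only: h_def nonneg_Reals_of_real_iff intro!: mult_nonneg_nonneg) auto
    moreover have "norm (f n y) \<le> norm (h n)" if "y \<in> ball x (r - norm x) \<inter> ball 0 1" for y n
    proof -
      have yr: "norm y \<le> r"
        using that norm_triangle_ineq2[of y x] by (auto simp: dist_norm norm_minus_commute)
      have "norm (1 / (1 - y ^ (d * Suc n))) \<le> 1 / (1 - norm y)"
        using yr r kd by (intro norm_inverse_one_minus_power_le) auto
      also have "\<dots> \<le> 1 / (1 - r)" using yr r by (simp add: frac_le)
      finally have *: "norm (1 / (1 - y ^ (d * Suc n))) \<le> 1 / (1 - r)" .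
      have "norm (f n y) = norm (w n) * norm (y ^ (k * Suc n)) * norm (1 / (1 - y ^ (d * Suc n)))"
        by (simp add: f_def norm_mult norm_divide)
      also have "\<dots> \<le> real (Suc n) * r ^ Suc n * (1 / (1 - r))"
        by (intro mult_mono w norm_power_times_le yr r(2) kd *) (use r in auto)
      also have "\<dots> = norm (h n)" unfolding h_def norm_of_real using r by simp
      finally show ?thesis .
    qed
    ultimately show "\<exists>e h. 0 < e \<and> summable h \<and> range h \<subseteq> \<real>\<^sub>\<ge>\<^sub>0 \<and>
        (\<forall>\<^sub>F n in sequentially. \<forall>y\<in>ball x e \<inter> ball 0 1. cmod (f n y) \<le> cmod (h n))"
      using r by (intro exI[of _ "r - norm x"] exI[of _ h]) auto
  qed auto
  then obtain g g' where g: "\<And>x. x \<in> ball 0 1 \<Longrightarrow> (\<lambda>n. f n x) sums g x"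
    "\<And>x. x \<in> ball 0 1 \<Longrightarrow> (\<lambda>n. f' n x) sums g' x"
    "\<And>x. x \<in> ball 0 1 \<Longrightarrow> (g has_field_derivative g' x) (at x)" by blast
  have gl: "g x = lamb w k d x" if "x \<in> ball 0 1" for x
    using sums_unique[OF g(1)[OF that]] by (simp add: lamb_def f_def)
  have qb: "q \<in> ball 0 1" using q by simp
  have "(lamb w k d has_field_derivative g' q) (at q)"
    by (rule has_field_derivative_transform_within_open[OF g(3)[OF qb] open_ball qb]) (rule gl)
  moreover have "(\<lambda>n. q * f' n q) sums (q * g' q)"
    by (intro sums_mult g(2) qb)
  moreover have "q * f' n q = w n * of_nat (Suc n) * (of_nat k * q ^ (k * Suc n) / (1 - q ^ (d * Suc n))
        + of_nat d * (q ^ (k * Suc n) * q ^ (d * Suc n)) / (1 - q ^ (d * Suc n)) ^ 2)" for n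
  proof -
    have 1: "q * q ^ (k * Suc n - 1) = q ^ (k * Suc n)" "q * q ^ (d * Suc n - 1) = q ^ (d * Suc n)"
      using kd by (simp_all flip: power_Suc del: mult_Suc_right)
    show ?thesis
      unfolding f'_def 1[symmetric] by (simp add: algebra_simps add_divide_distrib del: mult_Suc_right)
  qed
  moreover have "g' q = (if k = 1 then w 0 else 0)" if "q = 0"
  proof (rule sums_unique2[OF g(2)[OF qb]])
    \<comment> \<open>At \<open>q = 0\<close> a power survives only if its exponent
      \<open>k * Suc n - 1\<close> is zero, that is for \<open>k = 1\<close> and
      \<open>n = 0\<close>.\<close>
    have "f' n q = 0" if "n \<noteq> 0 \<or> k \<noteq> 1" for n
    proof -
      have "k * Suc n \<noteq> 0" "k * Suc n \<noteq> 1"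
        using kd that by (auto simp only: nat_mult_eq_1_iff mult_eq_0_iff)
      hence "Suc 0 < k * Suc n" by linarith
      thus ?thesis using kd \<open>q = 0\<close> by (simp add: f'_def zero_power del: mult_Suc_right)
    qed
    moreover have "f' 0 q = w 0" if "k = 1"
      using kd that \<open>q = 0\<close> by (simp add: f'_def zero_power)
    ultimately show "(\<lambda>n. f' n q) sums (if k = 1 then w 0 else 0)"
      using sums_finite[of "{0}" "\<lambda>n. f' n q"] by auto
  qed
  ultimately show ?thesis
    using that[of "g' q"] g(1)[OF qb] gl[OF qb] by (simp add: f_def)
qed

section \<open>Logarithms of the infinite products as Lambert series\<close>

lemma Ln_sums_lamb:
  assumes kd: "k > 0" "d > 0" and q: "norm q < 1"
  shows "(\<lambda>j. Ln (1 - q ^ (k + d * j))) sums (- lamb (\<lambda>n. 1 / of_nat (Suc n)) k d q)"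
proof -
  define f where "f = (\<lambda>j n. q ^ ((k + d * j) * Suc n) / of_nat (Suc n) :: complex)"
  have 1: "norm (f j n) \<le> real (Suc j) * norm q ^ j * norm q ^ n" for j n
  proof -
    have "Suc j * Suc n \<le> (k + d * j) * Suc n"
    proof (rule mult_le_mono1)
      show "Suc j \<le> k + d * j" using kd mult_le_mono1[of 1 d j] by linarith
    qed
    hence "j + n \<le> (k + d * j) * Suc n" by simp
    hence "norm q ^ ((k + d * j) * Suc n) \<le> norm q ^ (j + n)"
      using q by (intro power_decreasing) auto
    hence "norm q ^ ((k + d * j) * Suc n) / real (Suc n) \<le> norm q ^ (j + n) / 1"
      by (intro frac_le) auto
    also have "\<dots> \<le> real (Suc j) * norm q ^ (j + n)"
      by (simp add: distrib_right)
    finally show ?thesis by (simp only: f_def norm_divide norm_power norm_of_nat power_add mult.assoc)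
  qed
  have 2: "f j sums (- Ln (1 - q ^ (k + d * j)))" for j
  proof -
    have "norm (- (q ^ (k + d * j))) < 1"
      using q kd by (simp add: norm_power power_less_one_iff)
    from sums_minus[OF Ln_series'[OF this]]
    have "(\<lambda>n. (q ^ (k + d * j)) ^ n / of_nat n) sums (- Ln (1 - q ^ (k + d * j)))"
      by simp
    \<comment> \<open>The term at \<open>n = 0\<close> is a division by zero, hence
      \<open>0\<close>, so the shift of the index leaves the sum unchanged.\<close>
    hence "(\<lambda>n. (q ^ (k + d * j)) ^ Suc n / of_nat (Suc n)) sums (- Ln (1 - q ^ (k + d * j)))"
      by (subst sums_Suc_iff) simp
    thus ?thesis by (simp only: f_def power_mult)
  qed
  have 3: "(\<lambda>j. f j n) sums (1 / of_nat (Suc n) * q ^ (k * Suc n) / (1 - q ^ (d * Suc n)))" for n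
  proof -
    have "norm (q ^ (d * Suc n)) < 1"
      using q kd by (simp only: norm_power power_less_one_iff norm_ge_zero) simp
    from sums_mult[OF geometric_sums[OF this], of "q ^ (k * Suc n) / of_nat (Suc n)"]
    have "(\<lambda>j. q ^ (k * Suc n) / of_nat (Suc n) * (q ^ (d * Suc n)) ^ j) sums
        (1 / of_nat (Suc n) * q ^ (k * Suc n) / (1 - q ^ (d * Suc n)))" by simp
    also have "(\<lambda>j. q ^ (k * Suc n) / of_nat (Suc n) * (q ^ (d * Suc n)) ^ j) = (\<lambda>j. f j n)"
    proof
      fix j
      have "q ^ ((k + d * j) * Suc n) = q ^ (k * Suc n) * (q ^ (d * Suc n)) ^ j"
        by (simp only: power_mult[symmetric] power_add[symmetric] distrib_right mult.assoc mult.commute[of "Suc n"])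
      thus "q ^ (k * Suc n) / of_nat (Suc n) * (q ^ (d * Suc n)) ^ j = f j n"
        by (simp only: f_def times_divide_eq_left)
    qed
    finally show ?thesis .
  qed
  \<comment> \<open>Summing the double series over \<open>n\<close> first gives the logarithms of
    the factors, summing over \<open>j\<close> first gives geometric series in
    \<open>q ^ (d * Suc n)\<close>.\<close>
  obtain S where S: "(\<lambda>j. - Ln (1 - q ^ (k + d * j))) sums S"
      "(\<lambda>n. 1 / of_nat (Suc n) * q ^ (k * Suc n) / (1 - q ^ (d * Suc n))) sums S"
    by (rule double_series_swap[OF norm_ge_zero q 1 2 3])
  have "lamb (\<lambda>n. 1 / of_nat (Suc n)) k d q = S"
    unfolding lamb_def using S(2) by (simp only: sums_unique[symmetric])
  thus ?thesis using sums_minus[OF S(1)] by simp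
qed

lemma qpoch_eq_exp:
  assumes kd: "k > 0" "d > 0" and q: "norm q < 1"
  shows "qpoch (q ^ k) (q ^ d) = exp (- lamb (\<lambda>n. 1 / of_nat (Suc n)) k d q)"
proof -
  note L = Ln_sums_lamb[OF assms]
  have "exp (Ln (1 - q ^ (k + d * j))) = 1 - q ^ k * (q ^ d) ^ j" for j
    using power_neq_1[OF q, of "k + d * j"] kd by (simp add: power_add power_mult)
  hence "qpoch (q ^ k) (q ^ d) = (\<Prod>j. exp (Ln (1 - q ^ (k + d * j))))"
    by (simp add: qpoch_def)
  also have "\<dots> = exp (\<Sum>j. Ln (1 - q ^ (k + d * j)))"
    by (rule prodinf_exp) (rule sums_summable[OF L])
  finally show ?thesis using sums_unique[OF L] by simp
qed

lemma euler_two_fifths_eq_exp: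
  assumes "norm q < 1"
  shows "euler_two_fifths q = exp (- (2 / 5) * lamb (\<lambda>n. 1 / of_nat (Suc n)) 1 1 q)"
proof -
  have "(\<lambda>j. Ln (1 - q * q ^ j)) sums (- lamb (\<lambda>n. 1 / of_nat (Suc n)) 1 1 q)"
    using Ln_sums_lamb[OF zero_less_one zero_less_one assms] by (simp only: power_add power_one_right mult_1)
  from sums_unique[OF this, symmetric] show ?thesis
    by (simp only: euler_two_fifths_def) (simp only: mult_minus_left mult_minus_right)
qed

section \<open>Specialization to fifth roots of the nome\<close>

lemma bilateral_algebra:
  fixes N s t u a :: complex
  shows "N * (t / a) + (s * N) * (- (u / a)) = N * ((t - s * u) / a)"
    and "N * (t / a) + (s * N) * (u / a) = N * ((t + s * u) / a)"
  by (simp_all add: diff_divide_distrib add_divide_distrib algebra_simps)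

text \<open>With \<open>t = q^(k m)\<close>, \<open>u = q^((5 - k) m)\<close> and
  \<open>a = q^(5 m)\<close>, the derivative terms of two one-sided series are regrouped into the
  terms of \<open>kS\<close> and \<open>kG\<close>. The \<open>5\<close> in \<open>5 - k\<close> is
  absorbed by \<open>1 / (1 - a) + a / (1 - a)^2 = 1 / (1 - a)^2\<close>.\<close>

lemma nome_derivative_algebra:
  fixes N k t u a :: complex
  assumes "1 - a \<noteq> 0"
  shows "N * (k * t / (1 - a) + 5 * (t * a) / (1 - a)\<^sup>2)
           - N * ((5 - k) * u / (1 - a) + 5 * (u * a) / (1 - a)\<^sup>2)
         = k * (N * ((t + u) / (1 - a))) + 5 * (N * ((t * a - u) / (1 - a)\<^sup>2))"
    and "N * (k * t / (1 - a) + 5 * (t * a) / (1 - a)\<^sup>2)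
           + N * ((5 - k) * u / (1 - a) + 5 * (u * a) / (1 - a)\<^sup>2)
         = k * (N * ((t - u) / (1 - a))) + 5 * (N * ((t * a + u) / (1 - a)\<^sup>2))"
proof -
  define b where "b = 1 - a"
  have a: "a = 1 - b" and b: "b \<noteq> 0" using assms by (auto simp: b_def)
  show "N * (k * t / (1 - a) + 5 * (t * a) / (1 - a)\<^sup>2)
           - N * ((5 - k) * u / (1 - a) + 5 * (u * a) / (1 - a)\<^sup>2)
         = k * (N * ((t + u) / (1 - a))) + 5 * (N * ((t * a - u) / (1 - a)\<^sup>2))"
    and "N * (k * t / (1 - a) + 5 * (t * a) / (1 - a)\<^sup>2)
           + N * ((5 - k) * u / (1 - a) + 5 * (u * a) / (1 - a)\<^sup>2)
         = k * (N * ((t - u) / (1 - a))) + 5 * (N * ((t * a + u) / (1 - a)\<^sup>2))"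
    unfolding a using b by (simp_all add: divide_simps power2_eq_square) (simp_all add: algebra_simps)
qed

section \<open>Folding of the bilateral series of nome \<open>q ^ 5\<close> at
  \<open>q ^ k\<close>\<close>

context
  fixes q :: complex and k :: nat
  assumes q: "q \<noteq> 0" "norm q < 1" and k: "0 < k" "k < 5"
begin

lemma nome_bounds:
  "norm (q ^ 5) < norm (q ^ k)" "norm (q ^ k) < 1" "norm (q ^ 5) < 1" "norm (q ^ 5 * q ^ k) < 1"
proof -
  show 1: "norm (q ^ 5) < norm (q ^ k)"
    unfolding norm_power using q k by (intro power_strict_decreasing) auto
  show 2: "norm (q ^ k) < 1"
    unfolding norm_power using q k by (simp add: power_less_one_iff)
  show 3: "norm (q ^ 5) < 1" using 1 2 by linarith
  show "norm (q ^ 5 * q ^ k) < 1"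
    using q k by (simp add: norm_power power_less_one_iff flip: power_add)
qed

lemma nome_power_neq_1: "1 - q ^ (5 * Suc n) \<noteq> 0"
  using q by (intro power_neq_1) auto

text \<open>Because \<open>t n * u n = a n\<close>, negative powers of \<open>q ^ k\<close>,
  combined with the nome, turn into positive powers of \<open>q ^ (5 - k)\<close>.\<close>

lemma bilateral_terms:
  defines "N \<equiv> \<lambda>n. int (Suc n)"
  defines "t \<equiv> \<lambda>n. q ^ (k * Suc n)" and "u \<equiv> \<lambda>n. q ^ ((5 - k) * Suc n)" and "a \<equiv> \<lambda>n. q ^ (5 * Suc n)"
  shows "kc (q ^ 5) (N n) * (q ^ k) powi (N n) = t n / (1 - a n)"
    and "kc (q ^ 5) (- N n) * (q ^ k) powi (- N n) = - (u n / (1 - a n))"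
    and "kg (q ^ 5) (N n) * (q ^ k) powi (N n) = t n * a n / (1 - a n) ^ 2"
    and "kg (q ^ 5) (- N n) * (q ^ k) powi (- N n) = u n / (1 - a n) ^ 2"
proof -
  have nz: "a n \<noteq> 0" "t n \<noteq> 0" "1 - a n \<noteq> 0"
    using q nome_power_neq_1 by (auto simp: a_def t_def)
  have ap: "(q ^ 5) powi (N n) = a n"
    unfolding N_def a_def power_int_of_nat power_mult ..
  have tp: "(q ^ k) powi (N n) = t n"
    unfolding N_def t_def power_int_of_nat power_mult ..
  have "k * Suc n + (5 - k) * Suc n = 5 * Suc n"
    using k by (simp only: distrib_right[symmetric]) simp
  hence tu: "t n * u n = a n"
    unfolding t_def u_def a_def by (simp only: power_add[symmetric])
  hence u: "u n = a n / t n" using nz by (simp add: field_simps)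
  have N: "N n \<noteq> 0" "- N n \<noteq> 0" by (auto simp: N_def)
  show "kc (q ^ 5) (N n) * (q ^ k) powi (N n) = t n / (1 - a n)"
    using N unfolding kc_def ap tp by simp
  show "kg (q ^ 5) (N n) * (q ^ k) powi (N n) = t n * a n / (1 - a n) ^ 2"
    using N unfolding kg_def ap tp by simp
  have 1: "1 / (1 - inverse (a n)) = - (a n / (1 - a n))"
  proof -
    have "a n - 1 \<noteq> 0" using nz(3) by auto
    thus ?thesis using nz by (simp add: divide_simps) (simp add: algebra_simps)
  qed
  show "kc (q ^ 5) (- N n) * (q ^ k) powi (- N n) = - (u n / (1 - a n))"
    using N unfolding kc_def power_int_minus ap tp u using 1 by (simp add: divide_inverse)
  have 2: "inverse (a n) / (1 - inverse (a n)) ^ 2 = a n / (1 - a n) ^ 2"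
  proof -
    have "inverse (a n) / (1 - inverse (a n)) ^ 2 = inverse (a n) * (1 / (1 - inverse (a n))) ^ 2"
      by (simp add: power_divide divide_inverse power_inverse)
    also have "\<dots> = a n / (1 - a n) ^ 2"
      unfolding 1 using nz by (simp add: divide_simps power2_eq_square)
    finally show ?thesis .
  qed
  show "kg (q ^ 5) (- N n) * (q ^ k) powi (- N n) = u n / (1 - a n) ^ 2"
    using N unfolding kg_def power_int_minus ap tp u using 2 by (simp add: divide_inverse)
qed

text \<open>The sign \<open>(- 1) ^ j\<close> is the parity of the weight under folding. The term at
  index \<open>0\<close> survives only for \<open>j = 0\<close>, with the value
  \<open>1 / 2\<close>; in \<open>kG_nat_sums\<close> it is \<open>- 1 / 12\<close>.\<close>

lemma kS_nat_sums:
  "(\<lambda>n. of_nat (Suc n) ^ j * ((q ^ (k * Suc n) - (- 1) ^ j * q ^ ((5 - k) * Suc n)) / (1 - q ^ (5 * Suc n))))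
     sums (kS j (q ^ 5) (q ^ k) - (if j = 0 then 1 / 2 else 0))"
proof -
  have "q ^ 5 \<noteq> 0" using q by simp
  from has_sum_int_imp_sums[OF kS_has_sum[OF this nome_bounds(1,2), of j]]
  have "(\<lambda>n. of_int (int (Suc n)) ^ j * (q ^ (k * Suc n) / (1 - q ^ (5 * Suc n)))
      + of_int (- int (Suc n)) ^ j * (- (q ^ ((5 - k) * Suc n) / (1 - q ^ (5 * Suc n)))))
     sums (kS j (q ^ 5) (q ^ k) - 0 ^ j * (1 / 2))"
    unfolding bilateral_terms by (simp add: kc_def[of _ 0])
  also have "(\<lambda>n. of_int (int (Suc n)) ^ j * (q ^ (k * Suc n) / (1 - q ^ (5 * Suc n)))
      + of_int (- int (Suc n)) ^ j * (- (q ^ ((5 - k) * Suc n) / (1 - q ^ (5 * Suc n)))))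
    = (\<lambda>n. of_nat (Suc n) ^ j * ((q ^ (k * Suc n) - (- 1) ^ j * q ^ ((5 - k) * Suc n)) / (1 - q ^ (5 * Suc n))))"
    using power_minus[of "of_nat (Suc _) :: complex"] bilateral_algebra(1)
    by (simp only: of_int_minus of_int_of_nat_eq)
  also have "0 ^ j * (1 / 2) = (if j = 0 then 1 / 2 else 0 :: complex)" by simp
  finally show ?thesis .
qed

lemma kG_nat_sums:
  "(\<lambda>n. of_nat (Suc n) ^ j * ((q ^ (k * Suc n) * q ^ (5 * Suc n) + (- 1) ^ j * q ^ ((5 - k) * Suc n)) / (1 - q ^ (5 * Suc n)) ^ 2))
     sums (kG j (q ^ 5) (q ^ k) + (if j = 0 then 1 / 12 else 0))"
proof -
  have "q ^ 5 \<noteq> 0" using q by simp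
  from has_sum_int_imp_sums[OF kG_has_sum[OF this nome_bounds(3,1,4), of j]]
  have "(\<lambda>n. of_int (int (Suc n)) ^ j * (q ^ (k * Suc n) * q ^ (5 * Suc n) / (1 - q ^ (5 * Suc n)) ^ 2)
      + of_int (- int (Suc n)) ^ j * (q ^ ((5 - k) * Suc n) / (1 - q ^ (5 * Suc n)) ^ 2))
     sums (kG j (q ^ 5) (q ^ k) - 0 ^ j * (- 1 / 12))"
    unfolding bilateral_terms by (simp add: kg_def[of _ 0])
  also have "(\<lambda>n. of_int (int (Suc n)) ^ j * (q ^ (k * Suc n) * q ^ (5 * Suc n) / (1 - q ^ (5 * Suc n)) ^ 2)
      + of_int (- int (Suc n)) ^ j * (q ^ ((5 - k) * Suc n) / (1 - q ^ (5 * Suc n)) ^ 2))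
    = (\<lambda>n. of_nat (Suc n) ^ j * ((q ^ (k * Suc n) * q ^ (5 * Suc n) + (- 1) ^ j * q ^ ((5 - k) * Suc n)) / (1 - q ^ (5 * Suc n)) ^ 2))"
    using power_minus[of "of_nat (Suc _) :: complex"] bilateral_algebra(2)
    by (simp only: of_int_minus of_int_of_nat_eq)
  also have "kG j (q ^ 5) (q ^ k) - 0 ^ j * (- 1 / 12) = kG j (q ^ 5) (q ^ k) + (if j = 0 then 1 / 12 else 0)" by simp
  finally show ?thesis .
qed

end

text \<open>By \<open>qpoch_eq_exp\<close>, \<open>- lam k d q\<close> is a logarithm of
  \<open>qpoch (q ^ k) (q ^ d)\<close>, for positive \<open>k\<close> and \<open>d\<close> and
  \<open>norm q < 1\<close>.\<close>

definition lam :: "nat \<Rightarrow> nat \<Rightarrow> complex \<Rightarrow> complex" where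
  "lam = lamb (\<lambda>n. 1 / of_nat (Suc n))"

text \<open>
  For \<open>0 < k < 5\<close> and \<open>q \<noteq> 0\<close> these are \<open>kS 0\<close> and \<open>kS 1\<close> of nome \<open>q\<^sup>5\<close> at \<open>q\<^sup>k\<close>, rewritten such that
  they are defined and holomorphic at \<open>q = 0\<close> as well.
\<close>

definition zeta5 :: "nat \<Rightarrow> complex \<Rightarrow> complex" where
  "zeta5 k q = 1 / 2 + lamb (\<lambda>_. 1) k 5 q - lamb (\<lambda>_. 1) (5 - k) 5 q"

definition wp5 :: "nat \<Rightarrow> complex \<Rightarrow> complex" where
  "wp5 k q = lamb (\<lambda>n. of_nat (Suc n)) k 5 q + lamb (\<lambda>n. of_nat (Suc n)) (5 - k) 5 q"

lemma sums_unique_cong: "f sums s \<Longrightarrow> g sums t \<Longrightarrow> (\<And>n. f n = g n) \<Longrightarrow> s = (t :: complex)"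
  using sums_unique2 by (metis ext)

lemma norm_weights:
  "norm (1 / of_nat (Suc n) :: complex) \<le> real (Suc n)" "norm (1 :: complex) \<le> real (Suc n)"
  "norm (of_nat (Suc n) :: complex) \<le> real (Suc n)"
proof -
  have "1 / real (Suc n) \<le> 1" by (simp add: field_simps)
  thus "norm (1 / of_nat (Suc n) :: complex) \<le> real (Suc n)"
    by (simp only: norm_divide norm_of_nat norm_one)
qed (simp_all only: norm_one norm_of_nat order_refl)

section \<open>Derivatives in \<open>q\<close> of the series of nome \<open>q ^ 5\<close> at
  \<open>q ^ k\<close>\<close>

context
  fixes q :: complex and k :: nat
  assumes q: "q \<noteq> 0" "norm q < 1" and k: "0 < k" "k < 5"
begin

lemma k5: "0 < 5 - k" "0 < (5::nat)" using k by auto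

lemma zeta5_eq_kS: "zeta5 k q = kS 0 (q ^ 5) (q ^ k)"
proof -
  have 1: "(\<lambda>n. 1 * q ^ (k * Suc n) / (1 - q ^ (5 * Suc n))) sums lamb (\<lambda>_. 1) k 5 q"
    by (rule lamb_deriv[OF k(1) k5(2) norm_weights(2) q(2)]) blast
  have 2: "(\<lambda>n. 1 * q ^ ((5 - k) * Suc n) / (1 - q ^ (5 * Suc n))) sums lamb (\<lambda>_. 1) (5 - k) 5 q"
    by (rule lamb_deriv[OF k5(1,2) norm_weights(2) q(2)]) blast
  have "lamb (\<lambda>_. 1) k 5 q - lamb (\<lambda>_. 1) (5 - k) 5 q = kS 0 (q ^ 5) (q ^ k) - (if (0::nat) = 0 then 1 / 2 else 0)"
    by (rule sums_unique_cong[OF sums_diff[OF 1 2] kS_nat_sums[OF q k, of 0]])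
       (simp add: diff_divide_distrib)
  thus ?thesis by (simp add: zeta5_def algebra_simps)
qed

lemma wp5_eq_kS: "wp5 k q = kS 1 (q ^ 5) (q ^ k)"
proof -
  have 1: "(\<lambda>n. of_nat (Suc n) * q ^ (k * Suc n) / (1 - q ^ (5 * Suc n))) sums lamb (\<lambda>n. of_nat (Suc n)) k 5 q"
    by (rule lamb_deriv[OF k(1) k5(2) norm_weights(3) q(2)]) blast
  have 2: "(\<lambda>n. of_nat (Suc n) * q ^ ((5 - k) * Suc n) / (1 - q ^ (5 * Suc n))) sums lamb (\<lambda>n. of_nat (Suc n)) (5 - k) 5 q"
    by (rule lamb_deriv[OF k5(1,2) norm_weights(3) q(2)]) blast
  have "lamb (\<lambda>n. of_nat (Suc n)) k 5 q + lamb (\<lambda>n. of_nat (Suc n)) (5 - k) 5 q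
      = kS 1 (q ^ 5) (q ^ k) - (if (1::nat) = 0 then 1 / 2 else 0)"
    by (rule sums_unique_cong[OF sums_add[OF 1 2] kS_nat_sums[OF q k, of 1]])
       (simp only: power_one_right add_divide_distrib[symmetric] distrib_left[symmetric] times_divide_eq_right[symmetric]
         mult_minus_left mult_1_left diff_minus_eq_add)
  thus ?thesis by (simp add: wp5_def)
qed

text \<open>The chain rule for \<open>p = q^5\<close> and \<open>z = q^k\<close>:
  \<open>q d/dq\<close> is \<open>k z d/dz + 5 p d/dp\<close>, where \<open>z d/dz\<close> raises
  the order of \<open>kS\<close> and \<open>p d/dp\<close> turns \<open>kS j\<close> into
  \<open>kG (j + 1)\<close>. \<open>wp5_deriv\<close> is the same one order higher.\<close>

lemma zeta5_deriv:
  "\<exists>D. (zeta5 k has_field_derivative D) (at q) \<and>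
     q * D = of_nat k * kS 1 (q ^ 5) (q ^ k) + 5 * kG 1 (q ^ 5) (q ^ k)"
proof -
  let ?t = "\<lambda>n. q ^ (k * Suc n)" and ?u = "\<lambda>n. q ^ ((5 - k) * Suc n)" and ?a = "\<lambda>n. q ^ (5 * Suc n)"
  obtain D1 where 1: "(lamb (\<lambda>_. 1) k 5 has_field_derivative D1) (at q)"
    "(\<lambda>n. 1 * of_nat (Suc n) * (of_nat k * ?t n / (1 - ?a n) + of_nat 5 * (?t n * ?a n) / (1 - ?a n)\<^sup>2)) sums (q * D1)"
    by (rule lamb_deriv[OF k(1) k5(2) norm_weights(2) q(2)]) blast
  obtain D2 where 2: "(lamb (\<lambda>_. 1) (5 - k) 5 has_field_derivative D2) (at q)"
    "(\<lambda>n. 1 * of_nat (Suc n) * (of_nat (5 - k) * ?u n / (1 - ?a n) + of_nat 5 * (?u n * ?a n) / (1 - ?a n)\<^sup>2)) sums (q * D2)"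
    by (rule lamb_deriv[OF k5(1,2) norm_weights(2) q(2)]) blast
  have "(zeta5 k has_field_derivative (D1 - D2)) (at q)"
    unfolding zeta5_def[abs_def] by (auto intro!: derivative_eq_intros 1(1) 2(1))
  moreover have "q * D1 - q * D2 = of_nat k * (kS 1 (q ^ 5) (q ^ k) - (if (1::nat) = 0 then 1 / 2 else 0))
     + 5 * (kG 1 (q ^ 5) (q ^ k) + (if (1::nat) = 0 then 1 / 12 else 0))"
  proof (rule sums_unique_cong[OF sums_diff[OF 1(2) 2(2)]
        sums_add[OF sums_mult[OF kS_nat_sums[OF q k]] sums_mult[OF kG_nat_sums[OF q k]]]])
    fix n
    have "of_nat (5 - k) = (5 - of_nat k :: complex)" using k by (simp add: of_nat_diff)
    thus "1 * of_nat (Suc n) * (of_nat k * ?t n / (1 - ?a n) + of_nat 5 * (?t n * ?a n) / (1 - ?a n)\<^sup>2)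
       - 1 * of_nat (Suc n) * (of_nat (5 - k) * ?u n / (1 - ?a n) + of_nat 5 * (?u n * ?a n) / (1 - ?a n)\<^sup>2)
      = of_nat k * (of_nat (Suc n) ^ 1 * ((?t n - (- 1) ^ 1 * ?u n) / (1 - ?a n)))
       + 5 * (of_nat (Suc n) ^ 1 * ((?t n * ?a n + (- 1) ^ 1 * ?u n) / (1 - ?a n)\<^sup>2))"
      using nome_derivative_algebra(1)[OF nome_power_neq_1[OF q k], of "of_nat (Suc n)" "of_nat k" "?t n" n "?u n"]
      by (simp only: power_one_right mult_1_left mult_minus_left diff_minus_eq_add of_nat_numeral minus_diff_commute
           add_uminus_conv_diff)
  qed
  ultimately show ?thesis by (intro exI[of _ "D1 - D2"]) (simp add: algebra_simps)
qed

lemma wp5_deriv: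
  "\<exists>D. (wp5 k has_field_derivative D) (at q) \<and>
     q * D = of_nat k * kS 2 (q ^ 5) (q ^ k) + 5 * kG 2 (q ^ 5) (q ^ k)"
proof -
  let ?t = "\<lambda>n. q ^ (k * Suc n)" and ?u = "\<lambda>n. q ^ ((5 - k) * Suc n)" and ?a = "\<lambda>n. q ^ (5 * Suc n)"
  obtain D1 where 1: "(lamb (\<lambda>n. of_nat (Suc n)) k 5 has_field_derivative D1) (at q)"
    "(\<lambda>n. of_nat (Suc n) * of_nat (Suc n) * (of_nat k * ?t n / (1 - ?a n) + of_nat 5 * (?t n * ?a n) / (1 - ?a n)\<^sup>2)) sums (q * D1)"
    by (rule lamb_deriv[OF k(1) k5(2) norm_weights(3) q(2)]) blast
  obtain D2 where 2: "(lamb (\<lambda>n. of_nat (Suc n)) (5 - k) 5 has_field_derivative D2) (at q)"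
    "(\<lambda>n. of_nat (Suc n) * of_nat (Suc n) * (of_nat (5 - k) * ?u n / (1 - ?a n) + of_nat 5 * (?u n * ?a n) / (1 - ?a n)\<^sup>2)) sums (q * D2)"
    by (rule lamb_deriv[OF k5(1,2) norm_weights(3) q(2)]) blast
  have "(wp5 k has_field_derivative (D1 + D2)) (at q)"
    unfolding wp5_def[abs_def] by (intro derivative_intros 1(1) 2(1))
  moreover have "q * D1 + q * D2 = of_nat k * (kS 2 (q ^ 5) (q ^ k) - (if (2::nat) = 0 then 1 / 2 else 0))
     + 5 * (kG 2 (q ^ 5) (q ^ k) + (if (2::nat) = 0 then 1 / 12 else 0))"
  proof (rule sums_unique_cong[OF sums_add[OF 1(2) 2(2)]
        sums_add[OF sums_mult[OF kS_nat_sums[OF q k]] sums_mult[OF kG_nat_sums[OF q k]]]])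
    fix n
    have "of_nat (5 - k) = (5 - of_nat k :: complex)" using k by (simp add: of_nat_diff)
    thus "of_nat (Suc n) * of_nat (Suc n) * (of_nat k * ?t n / (1 - ?a n) + of_nat 5 * (?t n * ?a n) / (1 - ?a n)\<^sup>2)
       + of_nat (Suc n) * of_nat (Suc n) * (of_nat (5 - k) * ?u n / (1 - ?a n) + of_nat 5 * (?u n * ?a n) / (1 - ?a n)\<^sup>2)
      = of_nat k * (of_nat (Suc n) ^ 2 * ((?t n - (- 1) ^ 2 * ?u n) / (1 - ?a n)))
       + 5 * (of_nat (Suc n) ^ 2 * ((?t n * ?a n + (- 1) ^ 2 * ?u n) / (1 - ?a n)\<^sup>2))"
      using nome_derivative_algebra(2)[OF nome_power_neq_1[OF q k], of "of_nat (Suc n) * of_nat (Suc n)" "of_nat k" "?t n" n "?u n"]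
      by (simp only: power2_minus power_one mult_1_left power2_eq_square[of "of_nat _"] of_nat_numeral)
  qed
  ultimately show ?thesis by (intro exI[of _ "D1 + D2"]) (simp add: algebra_simps)
qed

text \<open>With the weight \<open>1 / n\<close>, the sum of the two logarithms is the part over
  \<open>n \<noteq> 0\<close> of a formal \<open>kS\<close> of order \<open>- 1\<close>. The chain
  rule then gives the series of order \<open>0\<close> without their terms at \<open>n = 0\<close>,
  which explains \<open>- 1 / 2\<close> and \<open>1 / 12\<close>.\<close>

lemma lam_deriv:
  "\<exists>D. ((\<lambda>q. lam k 5 q + lam (5 - k) 5 q) has_field_derivative D) (at q) \<and>
     q * D = of_nat k * (kS 0 (q ^ 5) (q ^ k) - 1 / 2) + 5 * (kG 0 (q ^ 5) (q ^ k) + 1 / 12)"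
proof -
  let ?t = "\<lambda>n. q ^ (k * Suc n)" and ?u = "\<lambda>n. q ^ ((5 - k) * Suc n)" and ?a = "\<lambda>n. q ^ (5 * Suc n)"
  obtain D1 where 1: "(lam k 5 has_field_derivative D1) (at q)"
    "(\<lambda>n. 1 / of_nat (Suc n) * of_nat (Suc n) * (of_nat k * ?t n / (1 - ?a n) + of_nat 5 * (?t n * ?a n) / (1 - ?a n)\<^sup>2)) sums (q * D1)"
    unfolding lam_def by (rule lamb_deriv[OF k(1) k5(2) norm_weights(1) q(2)]) blast
  obtain D2 where 2: "(lam (5 - k) 5 has_field_derivative D2) (at q)"
    "(\<lambda>n. 1 / of_nat (Suc n) * of_nat (Suc n) * (of_nat (5 - k) * ?u n / (1 - ?a n) + of_nat 5 * (?u n * ?a n) / (1 - ?a n)\<^sup>2)) sums (q * D2)"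
    unfolding lam_def by (rule lamb_deriv[OF k5(1,2) norm_weights(1) q(2)]) blast
  have "((\<lambda>q. lam k 5 q + lam (5 - k) 5 q) has_field_derivative (D1 + D2)) (at q)"
    by (intro derivative_intros 1(1) 2(1))
  moreover have "q * D1 + q * D2 = of_nat k * (kS 0 (q ^ 5) (q ^ k) - (if (0::nat) = 0 then 1 / 2 else 0))
     + 5 * (kG 0 (q ^ 5) (q ^ k) + (if (0::nat) = 0 then 1 / 12 else 0))"
  proof (rule sums_unique_cong[OF sums_add[OF 1(2) 2(2)]
        sums_add[OF sums_mult[OF kS_nat_sums[OF q k]] sums_mult[OF kG_nat_sums[OF q k]]]])
    fix n
    have "of_nat (5 - k) = (5 - of_nat k :: complex)" using k by (simp add: of_nat_diff)
    moreover have "1 / of_nat (Suc n) * of_nat (Suc n) = (1 :: complex)" by (simp del: of_nat_Suc)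
    ultimately show "1 / of_nat (Suc n) * of_nat (Suc n) * (of_nat k * ?t n / (1 - ?a n) + of_nat 5 * (?t n * ?a n) / (1 - ?a n)\<^sup>2)
       + 1 / of_nat (Suc n) * of_nat (Suc n) * (of_nat (5 - k) * ?u n / (1 - ?a n) + of_nat 5 * (?u n * ?a n) / (1 - ?a n)\<^sup>2)
      = of_nat k * (of_nat (Suc n) ^ 0 * ((?t n - (- 1) ^ 0 * ?u n) / (1 - ?a n)))
       + 5 * (of_nat (Suc n) ^ 0 * ((?t n * ?a n + (- 1) ^ 0 * ?u n) / (1 - ?a n)\<^sup>2))"
      using nome_derivative_algebra(2)[OF nome_power_neq_1[OF q k], of "1" "of_nat k" "?t n" n "?u n"]
      by (simp only: power_0 mult_1_left of_nat_numeral)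
  qed
  ultimately show ?thesis by (intro exI[of _ "D1 + D2"]) (simp add: algebra_simps)
qed

end

text \<open>Termwise splitting of the logarithmic derivative of \<open>qpoch q q\<close> by the
  exponents modulo \<open>5\<close>: the classes \<open>1, 4\<close> and \<open>2, 3\<close> give
  terms of \<open>kS 0\<close> and \<open>kG 0\<close>, the class \<open>0\<close> a term of
  \<open>E2 (q ^ 5)\<close>.\<close>

lemma quintisection:
  fixes t :: complex
  assumes "1 - t \<noteq> 0" "1 - t ^ 5 \<noteq> 0"
  shows "t / (1 - t) + t * t / (1 - t)\<^sup>2 =
    ((t - t ^ 4) / (1 - t ^ 5) + 5 * ((t * t ^ 5 + t ^ 4) / (1 - t ^ 5)\<^sup>2))
    + (2 * ((t ^ 2 - t ^ 3) / (1 - t ^ 5)) + 5 * ((t ^ 2 * t ^ 5 + t ^ 3) / (1 - t ^ 5)\<^sup>2))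
    + 5 * (t ^ 5 / (1 - t ^ 5)\<^sup>2)"
proof -
  define N where "N = (t - t ^ 4 + 2 * (t ^ 2 - t ^ 3)) * (1 - t ^ 5)
    + 5 * (t * t ^ 5 + t ^ 4 + t ^ 2 * t ^ 5 + t ^ 3 + t ^ 5)"
  have L: "t / (1 - t) + t * t / (1 - t)\<^sup>2 = t / (1 - t)\<^sup>2"
    using assms(1) by (simp add: divide_simps power2_eq_square) (simp add: algebra_simps)
  have combine: "((t - t4) / b + 5 * ((t * t5 + t4) / b\<^sup>2)) + (2 * ((t2 - t3) / b) + 5 * ((t2 * t5 + t3) / b\<^sup>2)) + 5 * (t5 / b\<^sup>2)
      = ((t - t4 + 2 * (t2 - t3)) * b + 5 * (t * t5 + t4 + t2 * t5 + t3 + t5)) / b\<^sup>2"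
    if "b \<noteq> 0" for b t2 t3 t4 t5 :: complex
    using that by (simp add: divide_simps power2_eq_square) (simp add: algebra_simps)
  \<comment> \<open>\<open>N\<close> is the expansion of
    \<open>t (1 + t + t^2 + t^3 + t^4)^2\<close>.\<close>
  have "t * (1 - t ^ 5)\<^sup>2 = N * (1 - t)\<^sup>2"
    unfolding N_def by algebra
  hence "t / (1 - t)\<^sup>2 = N / (1 - t ^ 5)\<^sup>2"
    using assms by (simp add: frac_eq_eq)
  thus ?thesis unfolding L combine[OF assms(2)] N_def .
qed

lemma lam_1_1_deriv:
  assumes q: "q \<noteq> 0" "norm q < 1"
  shows "\<exists>D. (lam 1 1 has_field_derivative D) (at q) \<and>
     q * D = (kS 0 (q ^ 5) q - 1 / 2) + 5 * (kG 0 (q ^ 5) q + 1 / 12)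
       + (2 * (kS 0 (q ^ 5) (q ^ 2) - 1 / 2) + 5 * (kG 0 (q ^ 5) (q ^ 2) + 1 / 12))
       + 5 * ((1 - E2 (q ^ 5)) / 24)"
proof -
  obtain D where D: "(lam 1 1 has_field_derivative D) (at q)"
    "(\<lambda>n. 1 / of_nat (Suc n) * of_nat (Suc n) * (of_nat 1 * q ^ (1 * Suc n) / (1 - q ^ (1 * Suc n))
      + of_nat 1 * (q ^ (1 * Suc n) * q ^ (1 * Suc n)) / (1 - q ^ (1 * Suc n))\<^sup>2)) sums (q * D)"
    unfolding lam_def by (rule lamb_deriv[OF zero_less_one zero_less_one norm_weights(1) q(2)]) blast
  have p: "norm (q ^ 5) < 1" using q by (simp add: norm_power power_less_one_iff)
  have k: "0 < (1::nat)" "(1::nat) < 5" "0 < (2::nat)" "(2::nat) < 5" by auto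
  have "q * D = (kS 0 (q ^ 5) (q ^ 1) - (if (0::nat) = 0 then 1 / 2 else 0)) + 5 * (kG 0 (q ^ 5) (q ^ 1) + (if (0::nat) = 0 then 1 / 12 else 0))
       + (2 * (kS 0 (q ^ 5) (q ^ 2) - (if (0::nat) = 0 then 1 / 2 else 0)) + 5 * (kG 0 (q ^ 5) (q ^ 2) + (if (0::nat) = 0 then 1 / 12 else 0)))
       + 5 * ((1 - E2 (q ^ 5)) / 24)"
  proof (rule sums_unique_cong[OF D(2) sums_add[OF sums_add[OF sums_add[OF kS_nat_sums[OF q k(1,2)] sums_mult[OF kG_nat_sums[OF q k(1,2)]]]
      sums_add[OF sums_mult[OF kS_nat_sums[OF q k(3,4)]] sums_mult[OF kG_nat_sums[OF q k(3,4)]]]] sums_mult[OF E2_sums[OF p]]]])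
    fix n
    define t where "t = q ^ Suc n"
    have pow: "q ^ (m * Suc n) = t ^ m" for m
      by (simp only: t_def power_mult[symmetric] mult.commute)
    have "1 - t \<noteq> 0"
      unfolding t_def by (rule power_neq_1[OF q(2)]) simp
    moreover have "1 - t ^ 5 \<noteq> 0"
      unfolding pow[symmetric] by (rule power_neq_1[OF q(2)]) simp
    ultimately have nz: "1 - t \<noteq> 0" "1 - t ^ 5 \<noteq> 0" .
    have "1 / of_nat (Suc n) * of_nat (Suc n) = (1 :: complex)" by (simp del: of_nat_Suc)
    moreover have "(q ^ 5) ^ Suc n = t ^ 5" by (simp only: t_def power_mult[symmetric] mult.commute)
    ultimately show "1 / of_nat (Suc n) * of_nat (Suc n) * (of_nat 1 * q ^ (1 * Suc n) / (1 - q ^ (1 * Suc n))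
        + of_nat 1 * (q ^ (1 * Suc n) * q ^ (1 * Suc n)) / (1 - q ^ (1 * Suc n))\<^sup>2)
      = of_nat (Suc n) ^ 0 * ((q ^ (1 * Suc n) - (- 1) ^ 0 * q ^ ((5 - 1) * Suc n)) / (1 - q ^ (5 * Suc n)))
        + 5 * (of_nat (Suc n) ^ 0 * ((q ^ (1 * Suc n) * q ^ (5 * Suc n) + (- 1) ^ 0 * q ^ ((5 - 1) * Suc n)) / (1 - q ^ (5 * Suc n))\<^sup>2))
        + (2 * (of_nat (Suc n) ^ 0 * ((q ^ (2 * Suc n) - (- 1) ^ 0 * q ^ ((5 - 2) * Suc n)) / (1 - q ^ (5 * Suc n))))
        + 5 * (of_nat (Suc n) ^ 0 * ((q ^ (2 * Suc n) * q ^ (5 * Suc n) + (- 1) ^ 0 * q ^ ((5 - 2) * Suc n)) / (1 - q ^ (5 * Suc n))\<^sup>2)))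
        + 5 * ((q ^ 5) ^ Suc n / (1 - (q ^ 5) ^ Suc n)\<^sup>2)"
      using quintisection[OF nz] by (simp add: pow of_nat_Suc[of 0] del: power_Suc of_nat_Suc mult_Suc_right mult_Suc)
  qed
  thus ?thesis using D(1) by auto
qed

text \<open>\<open>kg\<close> is even in \<open>n\<close>, so folding gives twice the series of
  \<open>E2_sums\<close>; its constant \<open>2 / 24\<close> cancels against the regularized term
  \<open>- 1 / 12\<close> at \<open>n = 0\<close>.\<close>

lemma kG_0_eq_E2:
  assumes p: "p \<noteq> 0" "norm p < 1"
  shows "kG 0 p 1 = - E2 p / 12"
proof -
  have "((\<lambda>n. of_int n ^ 0 * (kg p n * 1 powi n)) has_sum kG 0 p 1) UNIV"
    using p by (intro kG_has_sum) auto
  from has_sum_int_imp_sums[OF this]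
  have 1: "(\<lambda>n. kg p (int (Suc n)) + kg p (- int (Suc n))) sums (kG 0 p 1 + 1 / 12)"
    by (simp add: kg_def[of p 0] del: of_nat_Suc)
  have "kG 0 p 1 + 1 / 12 = 2 * ((1 - E2 p) / 24)"
  proof (rule sums_unique_cong[OF 1 sums_mult[OF E2_sums[OF p(2)]]])
    fix n
    have nz: "int (Suc n) \<noteq> 0" by simp
    have "kg p (- int (Suc n)) = kg p (int (Suc n))"
      using kg_eq[OF p nz] kg_eq[OF p, of "- int (Suc n)"] by (simp add: add.commute)
    moreover have "kg p (int (Suc n)) = p ^ Suc n / (1 - p ^ Suc n)\<^sup>2"
      using nz unfolding kg_def power_int_of_nat by simp
    ultimately show "kg p (int (Suc n)) + kg p (- int (Suc n)) = 2 * (p ^ Suc n / (1 - p ^ Suc n)\<^sup>2)"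
      by (simp only: mult_2)
  qed
  thus ?thesis by (simp add: diff_divide_distrib)
qed

section \<open>The differential system of the Eisenstein series\<close>

text \<open>A weight one Eisenstein series of level five, which turns out to be the fifth power of
  \<open>fun_A\<close>. The constant makes it vanish at \<open>q = 0\<close>; that of
  \<open>eisB\<close> makes the value there \<open>1\<close>.\<close>

definition eisA :: "complex \<Rightarrow> complex" where
  "eisA q = zeta5 1 q - 3 * zeta5 2 q + 1"

definition eisB :: "complex \<Rightarrow> complex" where
  "eisB q = 3 * zeta5 1 q + zeta5 2 q - 1"

text \<open>The elimination, free of analysis. The suffixes \<open>1\<close>, \<open>2\<close>,
  \<open>4\<close> are exponents of \<open>q\<close>; \<open>r\<close>, \<open>q\<close>,
  \<open>s\<close> stand for \<open>kS 0\<close>, \<open>kS 1\<close>, \<open>kS 2\<close>, and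
  \<open>g\<close>, \<open>h\<close>, \<open>k\<close> for \<open>kG 0\<close>, \<open>kG 1\<close>,
  \<open>kG 2\<close>. The unknowns are found in the order \<open>g\<close>, \<open>q\<close>,
  \<open>h\<close>, \<open>s2\<close>, \<open>k2\<close>, each from linear equations once the
  earlier ones are known.\<close>

lemma quintic_elimination:
  fixes x y P r1 r2 r4 g1 g2 g4 q1 q2 q4 h1 h2 h4 s2 k2 c :: complex
  assumes "x = r1 - 3 * r2 + 1" "y = 3 * r1 + r2 - 1" "12 * c = - P"
    and reflect: "r4 = 1 - r1" "g4 = g1 + r1 - 1 / 2" "q4 = q1" "h4 = - (h1 + q1)"
    and add0: "r1 * r1 - r2 * (r1 + r1) = g1 + g1 + g2" "r2 * r2 - r4 * (r2 + r2) = g2 + g2 + g4"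
    and add1: "q1 * r1 - q2 * (r1 + r1) - r2 * q1 = h1 + h2" "q2 * r2 - q4 * (r2 + r2) - r4 * q2 = h2 + h4"
    and add2: "q1 * q1 - s2 * (r1 + r1) - q2 * (q1 + q1) = k2"
    and sq: "r1 ^ 2 = q1 - 2 * g1 - c" "r2 ^ 2 = q2 - 2 * g2 - c" "2 * r2 * q2 = s2 - 2 * h2"
  shows "300 * g1 = 11 * x^2 + 66 * x * y - 6 * x - y^2 - 18 * y - 6"
    and "300 * g2 = - (x^2) - 66 * x * y + 36 * x + 11 * y^2 - 12 * y - 24"
    and "12 * q2 = x^2 - 6 * x * y + y^2 - P"
    and "24 * (q1 + 5 * h1) = - (x^3) - 9 * x^2 * y + 41 * x * y^2 + x * P - 3 * y^3 + 3 * y * P"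
    and "24 * (2 * q2 + 5 * h2) = 3 * x^3 + 41 * x^2 * y + 9 * x * y^2 - 3 * x * P - y^3 + y * P"
    and "144 * (2 * s2 + 5 * k2) = - 5 * x^4 - 84 * x^3 * y + 98 * x^2 * y^2 + 10 * x^2 * P + 60 * x * y^3 - 60 * x * y * P - 5 * y^4 + 10 * y^2 * P - 5 * P^2"
proof -
  have r1: "10 * r1 = x + 3 * y + 2" and r2: "10 * r2 = - 3 * x + y + 4"
    unfolding assms(1,2) by (simp_all add: algebra_simps)
  have "2 * g4 = 2 * g1 + 2 * r1 - 1"
    unfolding reflect(2) by simp
  \<comment> \<open>Reflection removes \<open>r4\<close> and \<open>g4\<close>, and two independent
    linear equations for \<open>g1\<close> and \<open>g2\<close> remain.\<close>
  hence t: "2 * g1 + g2 = r1 * r1 - 2 * r1 * r2" "2 * (2 * g2 + g1) = 2 * (r2 * r2 - 2 * (1 - r1) * r2) - 2 * r1 + 1"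
    using add0 reflect(1) by algebra+
  show g1: "300 * g1 = 11 * x^2 + 66 * x * y - 6 * x - y^2 - 18 * y - 6"
    using t r1 r2 by algebra
  show g2: "300 * g2 = - (x^2) - 66 * x * y + 36 * x + 11 * y^2 - 12 * y - 24"
    using t r1 r2 by algebra
  have q1: "12 * q1 = x^2 + 6 * x * y + y^2 - P"
    using sq(1) r1 g1 assms(3) by algebra
  show q2: "12 * q2 = x^2 - 6 * x * y + y^2 - P"
    using sq(2) r2 g2 assms(3) by algebra
  have h: "h1 + h2 = q1 * r1 - 2 * q2 * r1 - r2 * q1" "h2 - h1 = q2 * r2 - 2 * q1 * r2 - (1 - r1) * q2 + q1"
    using add1 unfolding reflect by (simp_all add: algebra_simps)
  have h1: "120 * h1 = - (x^3) - 9 * x^2 * y - 2 * x^2 + 41 * x * y^2 - 12 * x * y + x * P - 3 * y^3 - 2 * y^2 + 3 * y * P + 2 * P"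
    using h q1 q2 r1 r2 by algebra
  have h2: "120 * h2 = 3 * x^3 + 41 * x^2 * y - 4 * x^2 + 9 * x * y^2 + 24 * x * y - 3 * x * P - y^3 - 4 * y^2 + y * P + 4 * P"
    using h q1 q2 r1 r2 by algebra
  \<comment> \<open>All terms but one cancel, including those with \<open>P\<close>:
    \<open>kS 2\<close> at \<open>q^2\<close> is a monomial in the two forms.\<close>
  have s2: "s2 = x^2 * y"
    using sq(3) r2 q2 h2 by algebra
  have k2: "720 * k2 = - 5 * x^4 - 84 * x^3 * y + 98 * x^2 * y^2 - 288 * x^2 * y + 10 * x^2 * P + 60 * x * y^3 - 60 * x * y * P - 5 * y^4 + 10 * y^2 * P - 5 * P^2"
  proof -
    have "720 * k2 = 5 * (12 * q1) * (12 * q1) - 144 * s2 * (10 * r1) - 10 * (12 * q2) * (12 * q1)"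
      unfolding add2[symmetric] by (simp add: algebra_simps)
    thus ?thesis unfolding s2 r1 q1 q2 by algebra
  qed
  show "24 * (q1 + 5 * h1) = - (x^3) - 9 * x^2 * y + 41 * x * y^2 + x * P - 3 * y^3 + 3 * y * P"
    using q1 h1 by algebra
  show "24 * (2 * q2 + 5 * h2) = 3 * x^3 + 41 * x^2 * y + 9 * x * y^2 - 3 * x * P - y^3 + y * P"
    using q2 h2 by algebra
  show "144 * (2 * s2 + 5 * k2) = - 5 * x^4 - 84 * x^3 * y + 98 * x^2 * y^2 + 10 * x^2 * P + 60 * x * y^3 - 60 * x * y * P - 5 * y^4 + 10 * y^2 * P - 5 * P^2"
    using s2 k2 by algebra
qed

context
  fixes q :: complex
  assumes q: "q \<noteq> 0" "norm q < 1"
begin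

lemma nome_nonzero: "q ^ 5 \<noteq> 0" "norm (q ^ 5) < 1"
  using q by (auto simp: norm_power power_less_one_iff)

lemma one_less_five: "0 < (1::nat)" "(1::nat) < 5"
  by simp_all

lemma nome_reflect: "q ^ 5 / q = q ^ 4"
  using q by (simp add: field_simps flip: power_Suc)

text \<open>The addition formulas are taken at the pairs \<open>q, q\<close> and
  \<open>q^2, q^2\<close>. Their products \<open>q^2\<close> and \<open>q^4\<close> lead to no new
  points, since reflection sends \<open>q^4 = q^5 / q\<close> back to \<open>q\<close>; this makes
  the system closed.\<close>

lemma quintic_system:
  defines "x \<equiv> eisA q" and "y \<equiv> eisB q" and "P \<equiv> E2 (q ^ 5)"
  shows "300 * kG 0 (q ^ 5) q = 11 * x^2 + 66 * x * y - 6 * x - y^2 - 18 * y - 6"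
    and "300 * kG 0 (q ^ 5) (q ^ 2) = - (x^2) - 66 * x * y + 36 * x + 11 * y^2 - 12 * y - 24"
    and "12 * wp5 2 q = x^2 - 6 * x * y + y^2 - P"
    and "24 * (kS 1 (q ^ 5) q + 5 * kG 1 (q ^ 5) q) = - (x^3) - 9 * x^2 * y + 41 * x * y^2 + x * P - 3 * y^3 + 3 * y * P"
    and "24 * (2 * kS 1 (q ^ 5) (q ^ 2) + 5 * kG 1 (q ^ 5) (q ^ 2)) = 3 * x^3 + 41 * x^2 * y + 9 * x * y^2 - 3 * x * P - y^3 + y * P"
    and "144 * (2 * kS 2 (q ^ 5) (q ^ 2) + 5 * kG 2 (q ^ 5) (q ^ 2)) = - 5 * x^4 - 84 * x^3 * y + 98 * x^2 * y^2 + 10 * x^2 * P + 60 * x * y^3 - 60 * x * y * P - 5 * y^4 + 10 * y^2 * P - 5 * P^2"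
proof -
  have b1: "norm (q ^ 5) < norm q" and b2: "norm (q ^ 2) < 1" "norm (q ^ 5) < norm (q ^ 2)"
    using nome_bounds[OF q, of 1] nome_bounds[OF q, of 2] by simp_all
  have b3: "norm (q ^ 5) < norm (q * q)" using b2(2) by (simp add: power2_eq_square)
  have b4: "norm (q ^ 5) < norm (q ^ 2 * q ^ 2)"
    using nome_bounds(1)[OF q, of 4] by (simp flip: power_add)
  have sq: "q * q = q ^ 2" "q ^ 2 * q ^ 2 = q ^ 4"
    by (simp_all add: power2_eq_square eval_nat_numeral)
  note add_q = kS_addition_0[OF nome_nonzero(1) q(2) q(2) b3]
    kS_addition_1[OF nome_nonzero(1) q(2) q(2) b3] kS_addition_2[OF nome_nonzero(1) q(2) q(2) b3]
  note add_q2 = kS_addition_0[OF nome_nonzero(1) b2(1) b2(1) b4]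
    kS_addition_1[OF nome_nonzero(1) b2(1) b2(1) b4]
  note refl = kS_0_reflect[OF nome_nonzero(1) b1 q(2)] kG_0_reflect[OF nome_nonzero(1) b1 q(2)]
    kS_1_reflect[OF nome_nonzero(1) b1 q(2)] kG_1_reflect[OF nome_nonzero(1) b1 q(2)]
  have r1: "zeta5 1 q = kS 0 (q ^ 5) q" and r2: "zeta5 2 q = kS 0 (q ^ 5) (q ^ 2)"
    and w2: "wp5 2 q = kS 1 (q ^ 5) (q ^ 2)"
    using zeta5_eq_kS[OF q one_less_five] zeta5_eq_kS[OF q, of 2] wp5_eq_kS[OF q, of 2]
    unfolding power_one_right by auto
  have c: "12 * kG 0 (q ^ 5) 1 = - E2 (q ^ 5)"
    using kG_0_eq_E2[OF nome_nonzero] by simp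
  have AB: "eisA q = kS 0 (q ^ 5) q - 3 * kS 0 (q ^ 5) (q ^ 2) + 1" "eisB q = 3 * kS 0 (q ^ 5) q + kS 0 (q ^ 5) (q ^ 2) - 1"
    by (simp_all only: eisA_def eisB_def r1 r2)
  note hyps = AB c refl[unfolded nome_reflect] add_q(1)[unfolded sq] add_q2(1)[unfolded sq]
    add_q(2)[unfolded sq] add_q2(2)[unfolded sq] add_q(3)[unfolded sq]
    kS_square[OF nome_nonzero(1) b1 q(2)] kS_square[OF nome_nonzero(1) b2(2,1)] kS_square_deriv[OF nome_nonzero(1) b2(2,1)]
  note res = quintic_elimination[OF hyps]
  show "300 * kG 0 (q ^ 5) q = 11 * x^2 + 66 * x * y - 6 * x - y^2 - 18 * y - 6"
    and "300 * kG 0 (q ^ 5) (q ^ 2) = - (x^2) - 66 * x * y + 36 * x + 11 * y^2 - 12 * y - 24"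
    and "12 * wp5 2 q = x^2 - 6 * x * y + y^2 - P"
    and "24 * (kS 1 (q ^ 5) q + 5 * kG 1 (q ^ 5) q) = - (x^3) - 9 * x^2 * y + 41 * x * y^2 + x * P - 3 * y^3 + 3 * y * P"
    and "24 * (2 * kS 1 (q ^ 5) (q ^ 2) + 5 * kG 1 (q ^ 5) (q ^ 2)) = 3 * x^3 + 41 * x^2 * y + 9 * x * y^2 - 3 * x * P - y^3 + y * P"
    and "144 * (2 * kS 2 (q ^ 5) (q ^ 2) + 5 * kG 2 (q ^ 5) (q ^ 2)) = - 5 * x^4 - 84 * x^3 * y + 98 * x^2 * y^2 + 10 * x^2 * P + 60 * x * y^3 - 60 * x * y * P - 5 * y^4 + 10 * y^2 * P - 5 * P^2"
    using res unfolding x_def y_def P_def w2 by blast+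
qed

text \<open>The derivatives of the two forms are the combinations of those of \<open>zeta5 1\<close>
  and \<open>zeta5 2\<close> in which a factor \<open>x\<close> or \<open>y\<close> splits off. The
  derivative of \<open>wp5 2\<close> is included because \<open>E2 (q ^ 5)\<close> is a polynomial
  in the forms and \<open>wp5 2\<close>.\<close>

lemma eis_deriv:
  defines "x \<equiv> eisA q" and "y \<equiv> eisB q" and "P \<equiv> E2 (q ^ 5)"
  obtains DA DB DW where
    "(eisA has_field_derivative DA) (at q)" "12 * (q * DA) = x * (- 5 * x^2 - 66 * x * y + 7 * y^2 + 5 * P)"
    "(eisB has_field_derivative DB) (at q)" "12 * (q * DB) = y * (- 5 * y^2 + 66 * x * y + 7 * x^2 + 5 * P)"
    "(wp5 2 has_field_derivative DW) (at q)" "144 * (q * DW) = - 5 * x^4 - 84 * x^3 * y + 98 * x^2 * y^2 + 10 * x^2 * P + 60 * x * y^3 - 60 * x * y * P - 5 * y^4 + 10 * y^2 * P - 5 * P^2"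
proof -
  obtain D1 where 1: "(zeta5 1 has_field_derivative D1) (at q)" "q * D1 = kS 1 (q ^ 5) q + 5 * kG 1 (q ^ 5) q"
    using zeta5_deriv[OF q one_less_five] unfolding power_one_right of_nat_1 mult_1_left by blast
  obtain D2 where 2: "(zeta5 2 has_field_derivative D2) (at q)" "q * D2 = 2 * kS 1 (q ^ 5) (q ^ 2) + 5 * kG 1 (q ^ 5) (q ^ 2)"
    using zeta5_deriv[OF q, of 2] by auto
  obtain DW where 3: "(wp5 2 has_field_derivative DW) (at q)" "q * DW = 2 * kS 2 (q ^ 5) (q ^ 2) + 5 * kG 2 (q ^ 5) (q ^ 2)"
    using wp5_deriv[OF q, of 2] by auto
  note sys = quintic_system(4-6)[folded 1(2) 2(2) 3(2) x_def y_def P_def]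
  have "(eisA has_field_derivative (D1 - 3 * D2)) (at q)"
    using DERIV_add[OF DERIV_diff[OF 1(1) DERIV_cmult[OF 2(1), of 3]] DERIV_const[of 1]]
    unfolding eisA_def[abs_def] add_0_right .
  moreover have "12 * (q * (D1 - 3 * D2)) = x * (- 5 * x^2 - 66 * x * y + 7 * y^2 + 5 * P)"
  proof -
    have "24 * (q * (D1 - 3 * D2)) = 24 * (q * D1) - 3 * (24 * (q * D2))" by (simp add: algebra_simps)
    also have "\<dots> = 2 * (x * (- 5 * x^2 - 66 * x * y + 7 * y^2 + 5 * P))"
      unfolding sys by algebra
    finally show ?thesis by simp
  qed
  moreover have "(eisB has_field_derivative (3 * D1 + D2)) (at q)"
    using DERIV_diff[OF DERIV_add[OF DERIV_cmult[OF 1(1), of 3] 2(1)] DERIV_const[of 1]]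
    unfolding eisB_def[abs_def] diff_0_right .
  moreover have "12 * (q * (3 * D1 + D2)) = y * (- 5 * y^2 + 66 * x * y + 7 * x^2 + 5 * P)"
  proof -
    have "24 * (q * (3 * D1 + D2)) = 3 * (24 * (q * D1)) + 24 * (q * D2)" by (simp add: algebra_simps)
    also have "\<dots> = 2 * (y * (- 5 * y^2 + 66 * x * y + 7 * x^2 + 5 * P))"
      unfolding sys by algebra
    finally show ?thesis by simp
  qed
  ultimately show ?thesis using that 3(1) sys(3) by blast
qed

text \<open>The functions differentiated are logarithms of \<open>A^5 / q\<close> and
  \<open>B^5\<close> in terms of the products; the \<open>1\<close> in \<open>1 + q * DA\<close> is
  the contribution of the factor \<open>q\<close>. The results match the logarithmic derivatives in
  \<open>eis_deriv\<close>.\<close>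

lemma log_product_deriv:
  defines "x \<equiv> eisA q" and "y \<equiv> eisB q" and "P \<equiv> E2 (q ^ 5)"
  obtains DA DB where
    "((\<lambda>q. - 2 * lam 1 1 q + 5 * (lam 2 5 q + lam 3 5 q)) has_field_derivative DA) (at q)"
    "12 * (1 + q * DA) = - 5 * x^2 - 66 * x * y + 7 * y^2 + 5 * P"
    "((\<lambda>q. - 2 * lam 1 1 q + 5 * (lam 1 5 q + lam 4 5 q)) has_field_derivative DB) (at q)"
    "12 * (q * DB) = - 5 * y^2 + 66 * x * y + 7 * x^2 + 5 * P"
proof -
  define r1 r2 g1 g2 where "r1 = kS 0 (q ^ 5) q" and "r2 = kS 0 (q ^ 5) (q ^ 2)"
    and "g1 = kG 0 (q ^ 5) q" and "g2 = kG 0 (q ^ 5) (q ^ 2)"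
  obtain D0 where 0: "(lam 1 1 has_field_derivative D0) (at q)"
    "q * D0 = (r1 - 1 / 2) + 5 * (g1 + 1 / 12) + (2 * (r2 - 1 / 2) + 5 * (g2 + 1 / 12)) + 5 * ((1 - P) / 24)"
    using lam_1_1_deriv[OF q] unfolding r1_def r2_def g1_def g2_def P_def by blast
  obtain D1 where 1: "((\<lambda>q. lam 1 5 q + lam 4 5 q) has_field_derivative D1) (at q)"
    "q * D1 = (r1 - 1 / 2) + 5 * (g1 + 1 / 12)"
    using lam_deriv[OF q one_less_five] unfolding power_one_right of_nat_1 mult_1_left r1_def g1_def by auto
  obtain D2 where 2: "((\<lambda>q. lam 2 5 q + lam 3 5 q) has_field_derivative D2) (at q)"
    "q * D2 = 2 * (r2 - 1 / 2) + 5 * (g2 + 1 / 12)"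
    using lam_deriv[OF q, of 2] by (auto simp: r2_def g2_def)
  have r: "x = r1 - 3 * r2 + 1" "y = 3 * r1 + r2 - 1"
    using zeta5_eq_kS[OF q one_less_five] zeta5_eq_kS[OF q, of 2] unfolding power_one_right
    by (simp_all only: x_def y_def eisA_def eisB_def r1_def r2_def zero_less_numeral numeral_less_iff semiring_norm)
  have r': "10 * r1 = x + 3 * y + 2" "10 * r2 = - 3 * x + y + 4"
    unfolding r by (simp_all add: algebra_simps)
  note sys = quintic_system(1,2)[folded g1_def g2_def x_def y_def P_def]
  have e0: "24 * (q * D0) = 24 * r1 + 120 * g1 + 48 * r2 + 120 * g2 - 5 * P - 11"
    and e1: "12 * (q * D1) = 12 * r1 + 60 * g1 - 1" and e2: "12 * (q * D2) = 24 * r2 + 60 * g2 - 7"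
    unfolding 0(2) 1(2) 2(2) by (simp_all add: field_simps)
  have "((\<lambda>q. - 2 * lam 1 1 q + 5 * (lam 2 5 q + lam 3 5 q)) has_field_derivative (- 2 * D0 + 5 * D2)) (at q)"
    by (intro DERIV_add DERIV_cmult 0(1) 2(1))
  moreover have "12 * (1 + q * (- 2 * D0 + 5 * D2)) = - 5 * x^2 - 66 * x * y + 7 * y^2 + 5 * P"
  proof -
    \<comment> \<open>The factor \<open>5\<close> makes the coefficients multiples of
      \<open>10\<close> for \<open>r1\<close>, \<open>r2\<close> and of \<open>300\<close> for
      \<open>g1\<close>, \<open>g2\<close>, as they occur in \<open>r'\<close> and
      \<open>sys\<close>.\<close>
    have "5 * (12 * (1 + q * (- 2 * D0 + 5 * D2))) = 60 - 5 * (24 * (q * D0)) + 25 * (12 * (q * D2))"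
      by (simp add: algebra_simps)
    also have "\<dots> = 115 + 25 * P - 12 * (10 * r1) + 36 * (10 * r2) - 2 * (300 * g1) + 3 * (300 * g2) - 175"
      unfolding e0 e2 by (simp add: algebra_simps)
    also have "\<dots> = 5 * (- 5 * x^2 - 66 * x * y + 7 * y^2 + 5 * P)"
      unfolding r' sys by algebra
    finally show ?thesis by (subst (asm) mult_left_cancel) auto
  qed
  moreover have "((\<lambda>q. - 2 * lam 1 1 q + 5 * (lam 1 5 q + lam 4 5 q)) has_field_derivative (- 2 * D0 + 5 * D1)) (at q)"
    by (intro DERIV_add DERIV_cmult 0(1) 1(1))
  moreover have "12 * (q * (- 2 * D0 + 5 * D1)) = - 5 * y^2 + 66 * x * y + 7 * x^2 + 5 * P"
  proof -
    have "5 * (12 * (q * (- 2 * D0 + 5 * D1))) = - 5 * (24 * (q * D0)) + 25 * (12 * (q * D1))"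
      by (simp add: algebra_simps)
    also have "\<dots> = 55 + 25 * P + 18 * (10 * r1) - 24 * (10 * r2) + 3 * (300 * g1) - 2 * (300 * g2) - 25"
      unfolding e0 e1 by (simp add: algebra_simps)
    also have "\<dots> = 5 * (- 5 * y^2 + 66 * x * y + 7 * x^2 + 5 * P)"
      unfolding r' sys by algebra
    finally show ?thesis by (subst (asm) mult_left_cancel) auto
  qed
  ultimately show ?thesis using that by blast
qed

end

section \<open>Comparison with the infinite products\<close>

text \<open>The differential equations hold in the punctured disc only; at the exceptional point
  \<open>0\<close> continuity suffices for constancy on the connected disc.\<close>

lemma constant_on_ball_if_deriv_0:
  fixes f :: "complex \<Rightarrow> complex"
  assumes "continuous_on (ball 0 1) f" "\<And>q. q \<noteq> 0 \<Longrightarrow> norm q < 1 \<Longrightarrow> (f has_field_derivative 0) (at q)"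
    and "norm q < 1"
  shows "f q = f 0"
proof -
  have "f constant_on ball 0 1"
    by (rule DERIV_zero_connected_constant_on[where K = "{0}"]) (use assms in auto)
  thus ?thesis using assms(3) by (auto simp: constant_on_def)
qed

section \<open>Differentiability on the disc and initial values at \<open>q = 0\<close>\<close>

lemma lam_field_differentiable:
  assumes "0 < k" "0 < d" "norm q < 1"
  shows "lam k d field_differentiable at q"
  unfolding lam_def
  by (rule lamb_deriv[OF assms(1,2) norm_weights(1) assms(3)]) (auto simp: field_differentiable_def)

lemma zeta5_field_differentiable:
  assumes "0 < k" "k < 5" "norm q < 1"
  shows "zeta5 k field_differentiable at q"
proof -
  have k: "0 < 5 - k" "0 < (5 :: nat)" using assms by auto
  obtain D1 where 1: "(lamb (\<lambda>_. 1) k 5 has_field_derivative D1) (at q)"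
    by (rule lamb_deriv[OF assms(1) k(2) norm_weights(2) assms(3)])
  obtain D2 where 2: "(lamb (\<lambda>_. 1) (5 - k) 5 has_field_derivative D2) (at q)"
    by (rule lamb_deriv[OF k norm_weights(2) assms(3)])
  have "(zeta5 k has_field_derivative (D1 - D2)) (at q)"
    unfolding zeta5_def[abs_def] by (auto intro!: derivative_eq_intros 1 2)
  thus ?thesis by (auto simp: field_differentiable_def)
qed

lemma wp5_field_differentiable:
  assumes "0 < k" "k < 5" "norm q < 1"
  shows "wp5 k field_differentiable at q"
proof -
  have k: "0 < 5 - k" "0 < (5 :: nat)" using assms by auto
  obtain D1 where 1: "(lamb (\<lambda>n. of_nat (Suc n)) k 5 has_field_derivative D1) (at q)"
    by (rule lamb_deriv[OF assms(1) k(2) norm_weights(3) assms(3)])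
  obtain D2 where 2: "(lamb (\<lambda>n. of_nat (Suc n)) (5 - k) 5 has_field_derivative D2) (at q)"
    by (rule lamb_deriv[OF k norm_weights(3) assms(3)])
  have "(wp5 k has_field_derivative (D1 + D2)) (at q)"
    unfolding wp5_def[abs_def] by (intro derivative_intros 1 2)
  thus ?thesis by (auto simp: field_differentiable_def)
qed

lemma eis_field_differentiable:
  assumes "norm q < 1"
  shows "eisA field_differentiable at q" "eisB field_differentiable at q"
  unfolding eisA_def[abs_def] eisB_def[abs_def]
  by (intro field_differentiable_add field_differentiable_diff field_differentiable_mult
      field_differentiable_const zeta5_field_differentiable assms; simp)+

text \<open>Among the four series in \<open>eisA\<close> only the one with \<open>k = 1\<close> has
  a linear term. The value \<open>1\<close> fixes the constant of integration in
  \<open>eisA_eq_exp\<close>.\<close>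

lemma eisA_deriv_0: "(eisA has_field_derivative 1) (at 0)"
proof -
  have pos: "0 < (1::nat)" "0 < (2::nat)" "0 < (3::nat)" "0 < (4::nat)" "0 < (5::nat)" "norm (0 :: complex) < 1" by auto
  have *: "(lamb (\<lambda>_. 1) k 5 has_field_derivative (if k = 1 then 1 else 0)) (at 0)" if "0 < k" for k
    by (rule lamb_deriv[OF that pos(5) norm_weights(2) pos(6)]) simp
  have "((\<lambda>q. 1 / 2 + lamb (\<lambda>_. 1) 1 5 q - lamb (\<lambda>_. 1) 4 5 q - 3 * (1 / 2 + lamb (\<lambda>_. 1) 2 5 q - lamb (\<lambda>_. 1) 3 5 q) + 1)
     has_field_derivative 1) (at 0)"
    using *[OF pos(1)] *[OF pos(2)] *[OF pos(3)] *[OF pos(4)] by (auto intro!: derivative_eq_intros)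
  thus ?thesis by (simp add: eisA_def[abs_def] zeta5_def)
qed

lemma eis_0: "eisA 0 = 0" "eisB 0 = 1"
  by (simp_all add: eisA_def eisB_def zeta5_def lamb_0)

lemma lam_0: "0 < k \<Longrightarrow> lam k d 0 = 0"
  by (simp add: lam_def lamb_0)

text \<open>Both sides have the same logarithmic derivative by \<open>eis_deriv\<close> and
  \<open>log_product_deriv\<close> and the same value \<open>1\<close> at \<open>q = 0\<close>, so
  \<open>eisB q * exp (- l q)\<close> is constant.\<close>

lemma eisB_eq_exp:
  assumes "norm q < 1"
  shows "eisB q = exp (- 2 * lam 1 1 q + 5 * (lam 1 5 q + lam 4 5 q))"
proof -
  define l where "l = (\<lambda>q. - 2 * lam 1 1 q + 5 * (lam 1 5 q + lam 4 5 q))"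
  have l: "l field_differentiable at z" if "norm z < 1" for z
    unfolding l_def using that
    by (intro field_differentiable_add field_differentiable_mult field_differentiable_const lam_field_differentiable) auto
  have "eisB q * exp (- l q) = eisB 0 * exp (- l 0)"
  proof (rule constant_on_ball_if_deriv_0[where f = "\<lambda>q. eisB q * exp (- l q)"])
    show "continuous_on (ball 0 1) (\<lambda>q. eisB q * exp (- l q))"
      using l eis_field_differentiable(2)
      by (intro continuous_intros continuous_at_imp_continuous_on ballI)
         (auto intro: field_differentiable_imp_continuous_at)
  next
    fix z :: complex assume z: "z \<noteq> 0" "norm z < 1"
    obtain DY where DY: "(eisB has_field_derivative DY) (at z)"
      "12 * (z * DY) = eisB z * (- 5 * (eisB z)^2 + 66 * eisA z * eisB z + 7 * (eisA z)^2 + 5 * E2 (z ^ 5))"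
      by (rule eis_deriv[OF z])
    obtain DL where DL: "(l has_field_derivative DL) (at z)"
      "12 * (z * DL) = - 5 * (eisB z)^2 + 66 * eisA z * eisB z + 7 * (eisA z)^2 + 5 * E2 (z ^ 5)"
      unfolding l_def by (rule log_product_deriv[OF z])
    have "12 * (z * DY) = 12 * (z * (eisB z * DL))"
      unfolding DY(2) DL(2)[symmetric] by (simp add: algebra_simps)
    hence "DY = eisB z * DL" using z by simp
    thus "((\<lambda>q. eisB q * exp (- l q)) has_field_derivative 0) (at z)"
      by (auto intro!: derivative_eq_intros DY(1) DL(1))
  qed (rule assms)
  hence "eisB q * exp (- l q) = 1" by (simp add: eis_0 l_def lam_0)
  hence "eisB q = exp (l q)" by (simp add: exp_minus field_simps)
  thus ?thesis by (simp only: l_def)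
qed

text \<open>The argument for \<open>eisB\<close> is applied after dividing by \<open>q\<close>,
  because \<open>eisA\<close> has a simple zero at \<open>0\<close>.\<close>

lemma eisA_eq_exp:
  assumes "norm q < 1"
  shows "eisA q = q * exp (- 2 * lam 1 1 q + 5 * (lam 2 5 q + lam 3 5 q))"
proof -
  define l where "l = (\<lambda>q. - 2 * lam 1 1 q + 5 * (lam 2 5 q + lam 3 5 q))"
  have l: "l field_differentiable at z" if "norm z < 1" for z
    unfolding l_def using that
    by (intro field_differentiable_add field_differentiable_mult field_differentiable_const lam_field_differentiable) auto
  have l0: "l 0 = 0" by (simp add: l_def lam_0)
  \<comment> \<open>The value \<open>1\<close> at \<open>0\<close> is the limit of the quotient,
    namely the derivative of \<open>eisA\<close> at \<open>0\<close> times
    \<open>exp (- l 0) = 1\<close>.\<close>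
  define V where "V = (\<lambda>q. if q = 0 then 1 else eisA q * exp (- l q) / q)"
  have "V q = V 0"
  proof (rule constant_on_ball_if_deriv_0)
    have "isCont V z" if z: "norm z < 1" for z
    proof (cases "z = 0")
      case True
      have "(\<lambda>h. eisA h / h) \<midarrow>0\<rightarrow> 1"
        using eisA_deriv_0 by (simp add: DERIV_def eis_0)
      moreover have "(\<lambda>h. exp (- l h)) \<midarrow>0\<rightarrow> exp (- l 0)"
        using field_differentiable_imp_continuous_at[OF l[of 0]] by (intro tendsto_intros) (simp add: isCont_def)
      ultimately have "(\<lambda>h. eisA h / h * exp (- l h)) \<midarrow>0\<rightarrow> 1 * exp (- l 0)"
        by (rule tendsto_mult)
      hence "(\<lambda>h. eisA h / h * exp (- l h)) \<midarrow>0\<rightarrow> V 0" by (simp add: l0 V_def)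
      hence "V \<midarrow>0\<rightarrow> V 0"
        by (rule Lim_transform_eventually) (auto simp: V_def eventually_at_filter)
      thus ?thesis using True by (simp add: isCont_def)
    next
      case False
      have "isCont (\<lambda>q. eisA q * exp (- l q) / q) z"
        using z False l eis_field_differentiable(1)
        by (intro continuous_intros) (auto intro: field_differentiable_imp_continuous_at)
      moreover have "eventually (\<lambda>q. V q = eisA q * exp (- l q) / q) (nhds z)"
        using t1_space_nhds[OF False] by eventually_elim (simp add: V_def)
      ultimately show ?thesis using isCont_cong[of V] by simp
    qed
    thus "continuous_on (ball 0 1) V"
      by (intro continuous_at_imp_continuous_on) auto
  next
    fix z :: complex assume z: "z \<noteq> 0" "norm z < 1"
    obtain DX where DX: "(eisA has_field_derivative DX) (at z)"
      "12 * (z * DX) = eisA z * (- 5 * (eisA z)^2 - 66 * eisA z * eisB z + 7 * (eisB z)^2 + 5 * E2 (z ^ 5))"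
      by (rule eis_deriv[OF z])
    obtain DL where DL: "(l has_field_derivative DL) (at z)"
      "12 * (1 + z * DL) = - 5 * (eisA z)^2 - 66 * eisA z * eisB z + 7 * (eisB z)^2 + 5 * E2 (z ^ 5)"
      unfolding l_def by (rule log_product_deriv[OF z])
    have "12 * (z * DX) = 12 * (eisA z * (1 + z * DL))"
      unfolding DX(2) DL(2)[symmetric] by (simp add: algebra_simps)
    hence *: "z * DX = eisA z * (1 + z * DL)" by simp
    have "((\<lambda>q. eisA q * exp (- l q) / q) has_field_derivative
        ((DX * exp (- l z) - eisA z * (exp (- l z) * DL)) * z - eisA z * exp (- l z)) / (z * z)) (at z)"
      using z by (auto intro!: derivative_eq_intros DX(1) DL(1))
    also have "(DX * exp (- l z) - eisA z * (exp (- l z) * DL)) * z - eisA z * exp (- l z) =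
        exp (- l z) * (z * DX - eisA z * (1 + z * DL))" by (simp add: algebra_simps)
    also have "\<dots> = 0" unfolding * by simp
    finally have "((\<lambda>q. eisA q * exp (- l q) / q) has_field_derivative 0) (at z)" by simp
    thus "(V has_field_derivative 0) (at z)"
      by (rule has_field_derivative_transform_within_open[of _ _ _ "- {0}"]) (use z in \<open>auto simp: V_def\<close>)
  qed (rule assms)
  hence "eisA q * exp (- l q) = q"
    by (cases "q = 0") (auto simp: V_def eis_0)
  hence "eisA q = q * exp (l q)" by (simp add: exp_minus field_simps)
  thus ?thesis by (simp only: l_def)
qed

section \<open>The given functions in terms of the Eisenstein series\<close>

lemma fun_A_eq:
  assumes "norm q < 1"
  shows "fun_A r q = r q * exp (- (2 / 5) * lam 1 1 q + (lam 2 5 q + lam 3 5 q))"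
proof -
  have "qpoch (q ^ 2) (q ^ 5) = exp (- lam 2 5 q)" "qpoch (q ^ 3) (q ^ 5) = exp (- lam 3 5 q)"
    using qpoch_eq_exp[OF _ _ assms, of 2 5] qpoch_eq_exp[OF _ _ assms, of 3 5] by (simp_all add: lam_def)
  moreover have "euler_two_fifths q = exp (- (2 / 5) * lam 1 1 q)"
    unfolding lam_def by (rule euler_two_fifths_eq_exp[OF assms])
  ultimately have "fun_A r q = r q * exp (- (2 / 5) * lam 1 1 q) / (exp (- lam 2 5 q) * exp (- lam 3 5 q))"
    by (simp only: fun_A_def)
  thus ?thesis
    by (simp only: exp_add exp_minus) (simp add: field_simps)
qed

lemma fun_B_eq:
  assumes "norm q < 1"
  shows "fun_B q = exp (- (2 / 5) * lam 1 1 q + (lam 1 5 q + lam 4 5 q))"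
proof -
  have "qpoch q (q ^ 5) = exp (- lam 1 5 q)" "qpoch (q ^ 4) (q ^ 5) = exp (- lam 4 5 q)"
    using qpoch_eq_exp[OF _ _ assms, of 1 5] qpoch_eq_exp[OF _ _ assms, of 4 5] by (simp_all add: lam_def)
  moreover have "euler_two_fifths q = exp (- (2 / 5) * lam 1 1 q)"
    unfolding lam_def by (rule euler_two_fifths_eq_exp[OF assms])
  ultimately have "fun_B q = exp (- (2 / 5) * lam 1 1 q) / (exp (- lam 1 5 q) * exp (- lam 4 5 q))"
    by (simp only: fun_B_def)
  thus ?thesis
    by (simp only: exp_add exp_minus) (simp add: field_simps)
qed

lemma exp_power5: "exp t ^ 5 = exp (5 * t)" for t :: complex
  using exp_of_nat_mult[of 5 t] by simp

lemma fun_A_pow5: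
  assumes "norm q < 1" "r q ^ 5 = q"
  shows "fun_A r q ^ 5 = eisA q"
  unfolding fun_A_eq[OF assms(1)] eisA_eq_exp[OF assms(1)] power_mult_distrib assms(2)
    exp_power5 by (simp add: algebra_simps)

lemma fun_B_pow5:
  assumes "norm q < 1"
  shows "fun_B q ^ 5 = eisB q"
  unfolding fun_B_eq[OF assms(1)] eisB_eq_exp[OF assms(1)] exp_power5
  by (simp add: algebra_simps)

text \<open>The formula for \<open>wp5 2\<close> in \<open>quintic_system\<close>, solved for
  \<open>P\<close>. It expresses \<open>P\<close> by functions whose derivatives are known and,
  unlike the bilateral series, covers \<open>q = 0\<close>.\<close>

lemma scriptP_eq:
  assumes "norm q < 1"
  shows "scriptP q = eisA q ^ 2 - 6 * eisA q * eisB q + eisB q ^ 2 - 12 * wp5 2 q"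
proof (cases "q = 0")
  case True
  thus ?thesis by (simp add: scriptP_def E2_def eis_0 wp5_def lamb_0)
next
  case False
  thus ?thesis using quintic_system(3)[OF False assms] by (simp add: scriptP_def)
qed

lemma fun_B_field_differentiable:
  assumes "norm q < 1"
  shows "fun_B field_differentiable at q"
proof -
  have "(\<lambda>q. exp (- (2 / 5) * lam 1 1 q + (lam 1 5 q + lam 4 5 q))) field_differentiable at q"
    by (rule field_differentiable_compose[of _ _ exp, unfolded o_def])
       (intro field_differentiable_add field_differentiable_mult field_differentiable_const
          lam_field_differentiable assms field_differentiable_within_exp; simp)+
  then obtain D where "((\<lambda>q. exp (- (2 / 5) * lam 1 1 q + (lam 1 5 q + lam 4 5 q))) has_field_derivative D) (at q)"
    by (auto simp: field_differentiable_def)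
  hence "(fun_B has_field_derivative D) (at q)"
    by (rule has_field_derivative_transform_within_open[of _ _ _ "ball 0 1"]) (use assms fun_B_eq in auto)
  thus ?thesis by (auto simp: field_differentiable_def)
qed

lemma scriptP_field_differentiable:
  assumes "norm q < 1"
  shows "scriptP field_differentiable at q"
proof -
  have "(\<lambda>q. eisA q ^ 2 - 6 * eisA q * eisB q + eisB q ^ 2 - 12 * wp5 2 q) field_differentiable at q"
    by (intro field_differentiable_add field_differentiable_diff field_differentiable_mult field_differentiable_power
          field_differentiable_const eis_field_differentiable wp5_field_differentiable assms; simp)
  then obtain D where "((\<lambda>q. eisA q ^ 2 - 6 * eisA q * eisB q + eisB q ^ 2 - 12 * wp5 2 q) has_field_derivative D) (at q)"
    by (auto simp: field_differentiable_def)
  hence "(scriptP has_field_derivative D) (at q)"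
    by (rule has_field_derivative_transform_within_open[of _ _ _ "ball 0 1"]) (use assms scriptP_eq in auto)
  thus ?thesis by (auto simp: field_differentiable_def)
qed

text \<open>The logarithmic derivative of \<open>f\<close> is one fifth of that of
  \<open>f^5\<close>; this carries the equations for the two forms over to \<open>A\<close> and
  \<open>B\<close>.\<close>

lemma log_deriv_fifth_power:
  fixes f g :: "complex \<Rightarrow> complex"
  assumes "(f has_field_derivative D) (at q)" "(g has_field_derivative E) (at q)"
    and "open S" "q \<in> S" "\<And>z. z \<in> S \<Longrightarrow> f z ^ 5 = g z" "f q \<noteq> 0"
    and "q * E = g q * L"
  shows "q * D = f q * (L / 5)"
proof -
  have "((\<lambda>z. f z ^ 5) has_field_derivative (5 * f q ^ 4 * D)) (at q)"
    by (auto intro!: derivative_eq_intros assms(1))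
  moreover have "((\<lambda>z. f z ^ 5) has_field_derivative E) (at q)"
    by (rule has_field_derivative_transform_within_open[OF assms(2-4)]) (simp add: assms(5))
  ultimately have "E = 5 * f q ^ 4 * D" by (rule DERIV_unique[symmetric])
  hence "q * (5 * f q ^ 4 * D) = f q ^ 5 * L"
    using assms(7) assms(5)[OF assms(4)] by simp
  hence "f q ^ 4 * (5 * (q * D) - f q * L) = 0" by algebra
  hence "5 * (q * D) = f q * L" using assms(6) by simp
  hence "f q * (L / 5) = 5 * (q * D) / 5" by simp
  thus ?thesis by simp
qed

text \<open>The equations for \<open>B\<close> and \<open>P\<close> contain \<open>A\<close> only
  through powers of \<open>A^5\<close>, which do not depend on the choice of the fifth root, so they
  hold on the whole disc. The equation for \<open>A\<close> itself is local, on an open set where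
  \<open>r\<close> is a holomorphic branch.\<close>

theorem theorem1p3:
  fixes r :: "complex \<Rightarrow> complex" and U :: "complex set"
  assumes root: "\<And>q. norm q < 1 \<Longrightarrow> r q ^ 5 = q"
    and U: "open U" "U \<subseteq> ball 0 1 - {0}"
    and r_hol: "r holomorphic_on U"
  defines "A \<equiv> fun_A r" and "B \<equiv> fun_B" and "P \<equiv> scriptP"
  shows
    "(\<forall>q\<in>U. A field_differentiable at q \<and>
        q * deriv A q
          = 1 / 60 * A q * (- 5 * A q ^ 10 - 66 * A q ^ 5 * B q ^ 5 + 7 * B q ^ 10 + 5 * P q)) \<and>
     (\<forall>q\<in>ball 0 1. B field_differentiable at q \<and>
        q * deriv B q
          = 1 / 60 * B q * (- 5 * B q ^ 10 + 66 * A q ^ 5 * B q ^ 5 + 7 * A q ^ 10 + 5 * P q)) \<and>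
     (\<forall>q\<in>ball 0 1. P field_differentiable at q \<and>
        q * deriv P q
          = 5 / 12 * (P q ^ 2 - B q ^ 20 + 12 * B q ^ 15 * A q ^ 5 - 14 * B q ^ 10 * A q ^ 10
                      - 12 * B q ^ 5 * A q ^ 15 - A q ^ 20))"
proof -
  have A5: "A q ^ (5 * m) = eisA q ^ m" if "norm q < 1" for q m
    using fun_A_pow5[of q r, OF that root[OF that]] by (simp add: A_def power_mult)
  have B5: "B q ^ (5 * m) = eisB q ^ m" if "norm q < 1" for q m
    using fun_B_pow5[OF that] by (simp add: B_def power_mult)
  have pows: "A q ^ 5 = eisA q" "A q ^ 10 = eisA q ^ 2" "A q ^ 15 = eisA q ^ 3" "A q ^ 20 = eisA q ^ 4"
    "B q ^ 5 = eisB q" "B q ^ 10 = eisB q ^ 2" "B q ^ 15 = eisB q ^ 3" "B q ^ 20 = eisB q ^ 4"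
    if "norm q < 1" for q
    using A5[OF that, of 1] A5[OF that, of 2] A5[OF that, of 3] A5[OF that, of 4]
      B5[OF that, of 1] B5[OF that, of 2] B5[OF that, of 3] B5[OF that, of 4] by simp_all
  have P_eq: "P q = E2 (q ^ 5)" for q by (simp add: P_def scriptP_def)
  have P0: "P 0 = 1" by (simp add: P_def scriptP_def E2_def)

  have "A field_differentiable at q \<and>
      q * deriv A q = 1 / 60 * A q * (- 5 * A q ^ 10 - 66 * A q ^ 5 * B q ^ 5 + 7 * B q ^ 10 + 5 * P q)"
    if "q \<in> U" for q
  proof -
    have q: "q \<noteq> 0" "norm q < 1" using that U(2) by auto
    have "r field_differentiable at q"
      using r_hol U(1) that by (simp add: holomorphic_on_imp_differentiable_at)
    hence "(\<lambda>q. r q * exp (- (2 / 5) * lam 1 1 q + (lam 2 5 q + lam 3 5 q))) field_differentiable at q"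
      by (rule field_differentiable_mult)
         (rule field_differentiable_compose[of _ _ exp, unfolded o_def],
          (intro field_differentiable_add field_differentiable_mult field_differentiable_const
            lam_field_differentiable q(2) field_differentiable_within_exp; simp)+)
    then obtain D where "((\<lambda>q. r q * exp (- (2 / 5) * lam 1 1 q + (lam 2 5 q + lam 3 5 q))) has_field_derivative D) (at q)"
      by (auto simp: field_differentiable_def)
    hence D: "(A has_field_derivative D) (at q)"
      by (rule has_field_derivative_transform_within_open[of _ _ _ "ball 0 1"])
         (use q in \<open>auto simp: A_def fun_A_eq\<close>)
    obtain E where E: "(eisA has_field_derivative E) (at q)"
      "12 * (q * E) = eisA q * (- 5 * eisA q ^ 2 - 66 * eisA q * eisB q + 7 * eisB q ^ 2 + 5 * E2 (q ^ 5))"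
      by (rule eis_deriv[OF q])
    \<comment> \<open>By the product formula \<open>eisA\<close> has no zero in the punctured disc,
      so the factor \<open>A q ^ 4\<close> can be cancelled.\<close>
    have "eisA q \<noteq> 0" using q by (simp add: eisA_eq_exp)
    hence nz: "A q \<noteq> 0" using pows(1)[OF q(2)] by auto
    have "q * D = A q * ((- 5 * eisA q ^ 2 - 66 * eisA q * eisB q + 7 * eisB q ^ 2 + 5 * E2 (q ^ 5)) / 12 / 5)"
      by (rule log_deriv_fifth_power[OF D E(1) open_ball[of 0 1] _ _ nz]) (use q E(2) pows(1) in \<open>auto simp: field_simps\<close>)
    thus ?thesis
      using D DERIV_imp_deriv[OF D] by (auto simp: field_differentiable_def pows[OF q(2)] P_eq)
  qed
  moreover have "B field_differentiable at q \<and>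
      q * deriv B q = 1 / 60 * B q * (- 5 * B q ^ 10 + 66 * A q ^ 5 * B q ^ 5 + 7 * A q ^ 10 + 5 * P q)"
    if "q \<in> ball 0 1" for q
  proof -
    have q1: "norm q < 1" using that by simp
    have diff: "B field_differentiable at q"
      unfolding B_def by (rule fun_B_field_differentiable[OF q1])
    show ?thesis
    proof (cases "q = 0")
      \<comment> \<open>At \<open>q = 0\<close> the right side vanishes as well, because
        \<open>A^5 = 0\<close> and \<open>B^5 = P = 1\<close>.\<close>
      case True
      thus ?thesis using diff pows[OF q1] by (simp add: eis_0 P0)
    next
      case False
      obtain E where E: "(eisB has_field_derivative E) (at q)"
        "12 * (q * E) = eisB q * (- 5 * eisB q ^ 2 + 66 * eisA q * eisB q + 7 * eisA q ^ 2 + 5 * E2 (q ^ 5))"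
        by (rule eis_deriv[OF False q1])
      have D: "(B has_field_derivative deriv B q) (at q)"
        using diff by (simp add: field_differentiable_derivI)
      have nz: "B q \<noteq> 0" by (simp add: B_def fun_B_eq[OF q1])
      have "q * deriv B q = B q * ((- 5 * eisB q ^ 2 + 66 * eisA q * eisB q + 7 * eisA q ^ 2 + 5 * E2 (q ^ 5)) / 12 / 5)"
        by (rule log_deriv_fifth_power[OF D E(1) open_ball[of 0 1] _ _ nz]) (use q1 E(2) pows(5) in \<open>auto simp: field_simps\<close>)
      thus ?thesis using diff by (simp add: pows[OF q1] P_eq)
    qed
  qed
  moreover have "P field_differentiable at q \<and>
      q * deriv P q = 5 / 12 * (P q ^ 2 - B q ^ 20 + 12 * B q ^ 15 * A q ^ 5 - 14 * B q ^ 10 * A q ^ 10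
                      - 12 * B q ^ 5 * A q ^ 15 - A q ^ 20)"
    if "q \<in> ball 0 1" for q
  proof -
    have q1: "norm q < 1" using that by simp
    have diff: "P field_differentiable at q"
      unfolding P_def by (rule scriptP_field_differentiable[OF q1])
    show ?thesis
    proof (cases "q = 0")
      \<comment> \<open>Again both sides vanish: \<open>A^5 = 0\<close> and
        \<open>B^5 = P = 1\<close> leave \<open>1 - 1\<close> in the bracket.\<close>
      case True
      thus ?thesis using diff pows[OF q1] by (simp add: eis_0 P0)
    next
      case False
      define x y where "x = eisA q" and "y = eisB q"
      obtain DA DB DW where D:
        "(eisA has_field_derivative DA) (at q)" "12 * (q * DA) = x * (- 5 * x^2 - 66 * x * y + 7 * y^2 + 5 * P q)"
        "(eisB has_field_derivative DB) (at q)" "12 * (q * DB) = y * (- 5 * y^2 + 66 * x * y + 7 * x^2 + 5 * P q)"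
        "(wp5 2 has_field_derivative DW) (at q)" "144 * (q * DW) = - 5 * x^4 - 84 * x^3 * y + 98 * x^2 * y^2 + 10 * x^2 * P q + 60 * x * y^3 - 60 * x * y * P q - 5 * y^4 + 10 * y^2 * P q - 5 * P q ^ 2"
        unfolding x_def y_def P_eq by (rule eis_deriv[OF False q1])
      have "((\<lambda>q. eisA q ^ 2 - 6 * eisA q * eisB q + eisB q ^ 2 - 12 * wp5 2 q) has_field_derivative
          (2 * x * DA - 6 * (DA * y + x * DB) + 2 * y * DB - 12 * DW)) (at q)"
        unfolding x_def y_def by (auto intro!: derivative_eq_intros D(1,3,5) simp: algebra_simps)
      hence "(P has_field_derivative (2 * x * DA - 6 * (DA * y + x * DB) + 2 * y * DB - 12 * DW)) (at q)"
        by (rule has_field_derivative_transform_within_open[of _ _ _ "ball 0 1"])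
           (use q1 in \<open>auto simp: P_def scriptP_eq\<close>)
      hence "deriv P q = 2 * x * DA - 6 * (DA * y + x * DB) + 2 * y * DB - 12 * DW"
        by (rule DERIV_imp_deriv)
      hence "12 * (q * deriv P q) = 5 * (P q ^ 2 - y ^ 4 + 12 * y ^ 3 * x - 14 * y ^ 2 * x ^ 2 - 12 * y * x ^ 3 - x ^ 4)"
      proof -
        assume P': "deriv P q = 2 * x * DA - 6 * (DA * y + x * DB) + 2 * y * DB - 12 * DW"
        \<comment> \<open>The factors \<open>2 x - 6 y\<close> and \<open>2 y - 6 x\<close> are the
          partial derivatives of \<open>x^2 - 6 x y + y^2\<close> in
          \<open>scriptP_eq\<close>.\<close>
        have "12 * (q * deriv P q) = (2 * x - 6 * y) * (12 * (q * DA)) + (2 * y - 6 * x) * (12 * (q * DB)) - 144 * (q * DW)"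
          unfolding P' by (simp add: algebra_simps)
        thus ?thesis unfolding D(2,4,6) by algebra
      qed
      moreover have "a = 5 / 12 * b" if "12 * a = 5 * b" for a b :: complex
      proof -
        have "a = 12 * a / 12" by simp
        thus ?thesis unfolding that by simp
      qed
      ultimately have "q * deriv P q = 5 / 12 * (P q ^ 2 - y ^ 4 + 12 * y ^ 3 * x - 14 * y ^ 2 * x ^ 2 - 12 * y * x ^ 3 - x ^ 4)"
        by blast
      thus ?thesis using diff unfolding pows[OF q1] x_def y_def by blast
    qed
  qed
  ultimately show ?thesis by blast
qed

end
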